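(* Suppose $M_1$, $M_2$ and $M_3$ are three model category structures on the same underlying category $M$ such that the identity functors $M_1\to M_3$ and $M_2\to M_3$ are left Quillen functors. If the pullback $M_0$ of the diagram of model categories $M_1\to M_3\leftarrow M_2$ exists, with projections $M_0\to M_1$ and $M_0\to M_2$, then (up to equivalence) $M_0$ also has underlying category $M$ and the underlying functors of the left Quillen functors $M_0\to M_1$ and $M_0\to M_2$ are the identity of $M$.
   Context: The pullback is taken in the 2-category of model categories, with left Quillen functors as 1-morphisms and natural transformations as 2-morphisms, in the 2-categorical sense (bilimit): $M_0$ with its projections to the diagram (commuting up to specified isomorphism) is the pullback if for every model category $Z$ the induced functor from the category of left Quillen functors $Z\to M_0$ to the pseudopullback of the corresponding categories for $M_1,M_3,M_2$ is an equivalence of categories. "Up to equivalence" means that there is an equivalence between the underlying category of $M_0$ and $M$ under which both projections become isomorphic to $\mathrm{id}_M$. A model category is a complete and cocomplete category with classes of weak equivalences (satisfying two-out-of-three), cofibrations and fibrations such that (cofibrations, acyclic fibrations) and (acyclic cofibrations, fibrations) are weak factorization systems; a left Quillen functor is a left adjoint preserving cofibrations and acyclic cofibrations. (The paper also permits restricting to combinatorial model categories.) *)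

theory Defs
  imports Main "HOL-Library.FuncSet"
begin

unbundle cardinal_syntax

section \<open>Categories\<close>

text \<open>Composition is written in the usual order: \<open>g \<cdot> f\<close> is \<open>g\<close> after \<open>f\<close>. The fields are
  unspecified outside \<open>Obj\<close> and \<open>Arr\<close>.\<close>

record ('o, 'm) cat =
  Obj :: "'o set"
  Arr :: "'m set"
  Dom :: "'m \<Rightarrow> 'o"
  Cod :: "'m \<Rightarrow> 'o"
  Id :: "'o \<Rightarrow> 'm"
  Comp :: "'m \<Rightarrow> 'm \<Rightarrow> 'm" (infixr "\<cdot>\<index>" 70)

definition hom :: "('o, 'm) cat \<Rightarrow> 'o \<Rightarrow> 'o \<Rightarrow> 'm set" where
  "hom C a b = {f \<in> Arr C. Dom C f = a \<and> Cod C f = b}"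

locale category =
  fixes C :: "('o, 'm) cat" (structure)
  assumes Dom_in_Obj: "f \<in> Arr C \<Longrightarrow> Dom C f \<in> Obj C"
    and Cod_in_Obj: "f \<in> Arr C \<Longrightarrow> Cod C f \<in> Obj C"
    and Id_in_hom: "a \<in> Obj C \<Longrightarrow> Id C a \<in> hom C a a"
    and Comp_in_hom: "f \<in> hom C a b \<Longrightarrow> g \<in> hom C b c \<Longrightarrow> g \<cdot> f \<in> hom C a c"
    and Comp_Id: "f \<in> hom C a b \<Longrightarrow> f \<cdot> Id C a = f"
    and Id_Comp: "f \<in> hom C a b \<Longrightarrow> Id C b \<cdot> f = f"
    and Comp_assoc: "f \<in> hom C a b \<Longrightarrow> g \<in> hom C b c \<Longrightarrow> h \<in> hom C c d \<Longrightarrow>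
      (h \<cdot> g) \<cdot> f = h \<cdot> (g \<cdot> f)"

definition iso :: "('o, 'm) cat \<Rightarrow> 'm \<Rightarrow> bool" where
  "iso C f \<longleftrightarrow> f \<in> Arr C \<and>
    (\<exists>g \<in> hom C (Cod C f) (Dom C f).
      g \<cdot>\<^bsub>C\<^esub> f = Id C (Dom C f) \<and> f \<cdot>\<^bsub>C\<^esub> g = Id C (Cod C f))"

definition full_subcategory :: "('o, 'm) cat \<Rightarrow> ('o \<Rightarrow> bool) \<Rightarrow> ('o, 'm) cat" where
  "full_subcategory C P = C
    \<lparr>Obj := {a \<in> Obj C. P a}, Arr := {f \<in> Arr C. P (Dom C f) \<and> P (Cod C f)}\<rparr>"


section \<open>Functors and natural transformations\<close>

record ('o, 'm, 'p, 'n) ftor =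
  Fob :: "'o \<Rightarrow> 'p"
  Far :: "'m \<Rightarrow> 'n"

text \<open>Functors, and the families of components of natural transformations, are extensional
  (\<open>undefined\<close> outside the source), so that equality in HOL is equality of functors and of
  natural transformations.\<close>

definition is_functor ::
  "('o, 'm) cat \<Rightarrow> ('p, 'n) cat \<Rightarrow> ('o, 'm, 'p, 'n) ftor \<Rightarrow> bool" where
  "is_functor C D F \<longleftrightarrow> category C \<and> category D \<and>
    Fob F \<in> Obj C \<rightarrow>\<^sub>E Obj D \<and> Far F \<in> Arr C \<rightarrow>\<^sub>E Arr D \<and>
    (\<forall>f \<in> Arr C. Dom D (Far F f) = Fob F (Dom C f) \<and> Cod D (Far F f) = Fob F (Cod C f)) \<and>
    (\<forall>a \<in> Obj C. Far F (Id C a) = Id D (Fob F a)) \<and>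
    (\<forall>f \<in> Arr C. \<forall>g \<in> Arr C. Cod C f = Dom C g \<longrightarrow>
      Far F (g \<cdot>\<^bsub>C\<^esub> f) = Far F g \<cdot>\<^bsub>D\<^esub> Far F f)"

definition id_functor :: "('o, 'm) cat \<Rightarrow> ('o, 'm, 'o, 'm) ftor" where
  "id_functor C = \<lparr>Fob = (\<lambda>a\<in>Obj C. a), Far = (\<lambda>f\<in>Arr C. f)\<rparr>"

text \<open>\<open>comp_functor C G F\<close> is \<open>G\<close> after \<open>F\<close>, where \<open>C\<close> is the source of \<open>F\<close>.\<close>

definition comp_functor :: "('o, 'm) cat \<Rightarrow> ('p, 'n, 'q, 'k) ftor \<Rightarrow> ('o, 'm, 'p, 'n) ftor \<Rightarrow>
  ('o, 'm, 'q, 'k) ftor" where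
  "comp_functor C G F =
    \<lparr>Fob = (\<lambda>a\<in>Obj C. Fob G (Fob F a)), Far = (\<lambda>f\<in>Arr C. Far G (Far F f))\<rparr>"

definition nat_trans :: "('o, 'm) cat \<Rightarrow> ('p, 'n) cat \<Rightarrow> ('o, 'm, 'p, 'n) ftor \<Rightarrow>
  ('o, 'm, 'p, 'n) ftor \<Rightarrow> ('o \<Rightarrow> 'n) \<Rightarrow> bool" where
  "nat_trans C D F G \<tau> \<longleftrightarrow> is_functor C D F \<and> is_functor C D G \<and> \<tau> \<in> extensional (Obj C) \<and>
    (\<forall>a \<in> Obj C. \<tau> a \<in> hom D (Fob F a) (Fob G a)) \<and>
    (\<forall>f \<in> Arr C. \<tau> (Cod C f) \<cdot>\<^bsub>D\<^esub> Far F f = Far G f \<cdot>\<^bsub>D\<^esub> \<tau> (Dom C f))"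

definition nat_iso :: "('o, 'm) cat \<Rightarrow> ('p, 'n) cat \<Rightarrow> ('o, 'm, 'p, 'n) ftor \<Rightarrow>
  ('o, 'm, 'p, 'n) ftor \<Rightarrow> ('o \<Rightarrow> 'n) \<Rightarrow> bool" where
  "nat_iso C D F G \<tau> \<longleftrightarrow> nat_trans C D F G \<tau> \<and> (\<forall>a \<in> Obj C. iso D (\<tau> a))"

definition isomorphic_functors :: "('o, 'm) cat \<Rightarrow> ('p, 'n) cat \<Rightarrow> ('o, 'm, 'p, 'n) ftor \<Rightarrow>
  ('o, 'm, 'p, 'n) ftor \<Rightarrow> bool" where
  "isomorphic_functors C D F G \<longleftrightarrow> (\<exists>\<tau>. nat_iso C D F G \<tau>)"

definition is_equivalence :: "('o, 'm) cat \<Rightarrow> ('p, 'n) cat \<Rightarrow> ('o, 'm, 'p, 'n) ftor \<Rightarrow> bool" where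
  "is_equivalence C D F \<longleftrightarrow> is_functor C D F \<and>
    (\<exists>G. is_functor D C G \<and>
      isomorphic_functors C C (comp_functor C G F) (id_functor C) \<and>
      isomorphic_functors D D (comp_functor D F G) (id_functor D))"

definition whisker_left :: "('o, 'm) cat \<Rightarrow> ('p, 'n, 'q, 'k) ftor \<Rightarrow> ('o \<Rightarrow> 'n) \<Rightarrow> 'o \<Rightarrow> 'k" where
  "whisker_left C L \<tau> = (\<lambda>a\<in>Obj C. Far L (\<tau> a))"

definition whisker_right :: "('o, 'm) cat \<Rightarrow> ('p \<Rightarrow> 'k) \<Rightarrow> ('o, 'm, 'p, 'n) ftor \<Rightarrow> 'o \<Rightarrow> 'k" where
  "whisker_right C \<tau> F = (\<lambda>a\<in>Obj C. \<tau> (Fob F a))"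

definition left_adjoint :: "('o, 'm) cat \<Rightarrow> ('p, 'n) cat \<Rightarrow> ('o, 'm, 'p, 'n) ftor \<Rightarrow> bool" where
  "left_adjoint C D F \<longleftrightarrow> is_functor C D F \<and>
    (\<exists>G \<eta> \<epsilon>. is_functor D C G \<and>
      nat_trans C C (id_functor C) (comp_functor C G F) \<eta> \<and>
      nat_trans D D (comp_functor D F G) (id_functor D) \<epsilon> \<and>
      (\<forall>a \<in> Obj C. \<epsilon> (Fob F a) \<cdot>\<^bsub>D\<^esub> Far F (\<eta> a) = Id D (Fob F a)) \<and>
      (\<forall>b \<in> Obj D. Far G (\<epsilon> b) \<cdot>\<^bsub>C\<^esub> \<eta> (Fob G b) = Id C (Fob G b)))"

text \<open>An arrow of the functor category is a triple of its source, its target and the family of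
  its components.\<close>

type_synonym ('o, 'm, 'p, 'n) ntrans =
  "('o, 'm, 'p, 'n) ftor \<times> ('o, 'm, 'p, 'n) ftor \<times> ('o \<Rightarrow> 'n)"

definition functor_category :: "('o, 'm) cat \<Rightarrow> ('p, 'n) cat \<Rightarrow>
  (('o, 'm, 'p, 'n) ftor, ('o, 'm, 'p, 'n) ntrans) cat" where
  "functor_category C D = \<lparr>
    Obj = {F. is_functor C D F},
    Arr = {(F, G, \<tau>). nat_trans C D F G \<tau>},
    Dom = (\<lambda>(F, G, \<tau>). F),
    Cod = (\<lambda>(F, G, \<tau>). G),
    Id = (\<lambda>F. (F, F, \<lambda>a\<in>Obj C. Id D (Fob F a))),
    Comp = (\<lambda>(G', H, \<sigma>) (F, G, \<tau>). (F, H, \<lambda>a\<in>Obj C. \<sigma> a \<cdot>\<^bsub>D\<^esub> \<tau> a))\<rparr>"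

text \<open>The pseudopullback of \<open>F : A \<rightarrow> C\<close> and \<open>G : B \<rightarrow> C\<close>: objects are triples \<open>(a, b, \<phi>)\<close> with
  \<open>\<phi> : F a \<cong> G b\<close>, and arrows are pairs of arrows compatible with these isomorphisms, stored
  together with their source and target.\<close>

definition pseudopullback ::
  "('a, 'am) cat \<Rightarrow> ('b, 'bm) cat \<Rightarrow> ('c, 'cm) cat \<Rightarrow>
   ('a, 'am, 'c, 'cm) ftor \<Rightarrow> ('b, 'bm, 'c, 'cm) ftor \<Rightarrow>
   ('a \<times> 'b \<times> 'cm, ('a \<times> 'b \<times> 'cm) \<times> ('a \<times> 'b \<times> 'cm) \<times> 'am \<times> 'bm) cat" where
  "pseudopullback A B C F G = \<lparr>
    Obj = {(a, b, \<phi>). a \<in> Obj A \<and> b \<in> Obj B \<and> \<phi> \<in> hom C (Fob F a) (Fob G b) \<and> iso C \<phi>},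
    Arr = {((a, b, \<phi>), (a', b', \<phi>'), (f, g)).
      a \<in> Obj A \<and> b \<in> Obj B \<and> \<phi> \<in> hom C (Fob F a) (Fob G b) \<and> iso C \<phi> \<and>
      a' \<in> Obj A \<and> b' \<in> Obj B \<and> \<phi>' \<in> hom C (Fob F a') (Fob G b') \<and> iso C \<phi>' \<and>
      f \<in> hom A a a' \<and> g \<in> hom B b b' \<and> Far G g \<cdot>\<^bsub>C\<^esub> \<phi> = \<phi>' \<cdot>\<^bsub>C\<^esub> Far F f},
    Dom = (\<lambda>(x, y, f, g). x),
    Cod = (\<lambda>(x, y, f, g). y),
    Id = (\<lambda>(a, b, \<phi>). ((a, b, \<phi>), (a, b, \<phi>), (Id A a, Id B b))),
    Comp = (\<lambda>(y', z, f', g') (x, y, f, g). (x, z, f' \<cdot>\<^bsub>A\<^esub> f, g' \<cdot>\<^bsub>B\<^esub> g))\<rparr>"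


section \<open>Completeness and cocompleteness\<close>

definition is_cone :: "('i, 'j) cat \<Rightarrow> ('o, 'm) cat \<Rightarrow> ('i, 'j, 'o, 'm) ftor \<Rightarrow> 'o \<Rightarrow> ('i \<Rightarrow> 'm) \<Rightarrow>
  bool" where
  "is_cone J C D x \<pi> \<longleftrightarrow> x \<in> Obj C \<and> (\<forall>i \<in> Obj J. \<pi> i \<in> hom C x (Fob D i)) \<and>
    (\<forall>u \<in> Arr J. Far D u \<cdot>\<^bsub>C\<^esub> \<pi> (Dom J u) = \<pi> (Cod J u))"

definition is_limit :: "('i, 'j) cat \<Rightarrow> ('o, 'm) cat \<Rightarrow> ('i, 'j, 'o, 'm) ftor \<Rightarrow> 'o \<Rightarrow> ('i \<Rightarrow> 'm) \<Rightarrow>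
  bool" where
  "is_limit J C D x \<pi> \<longleftrightarrow> is_cone J C D x \<pi> \<and>
    (\<forall>y \<rho>. is_cone J C D y \<rho> \<longrightarrow> (\<exists>!h. h \<in> hom C y x \<and> (\<forall>i \<in> Obj J. \<pi> i \<cdot>\<^bsub>C\<^esub> h = \<rho> i)))"

definition is_cocone :: "('i, 'j) cat \<Rightarrow> ('o, 'm) cat \<Rightarrow> ('i, 'j, 'o, 'm) ftor \<Rightarrow> 'o \<Rightarrow>
  ('i \<Rightarrow> 'm) \<Rightarrow> bool" where
  "is_cocone J C D x \<iota> \<longleftrightarrow> x \<in> Obj C \<and> (\<forall>i \<in> Obj J. \<iota> i \<in> hom C (Fob D i) x) \<and>
    (\<forall>u \<in> Arr J. \<iota> (Cod J u) \<cdot>\<^bsub>C\<^esub> Far D u = \<iota> (Dom J u))"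

definition is_colimit :: "('i, 'j) cat \<Rightarrow> ('o, 'm) cat \<Rightarrow> ('i, 'j, 'o, 'm) ftor \<Rightarrow> 'o \<Rightarrow>
  ('i \<Rightarrow> 'm) \<Rightarrow> bool" where
  "is_colimit J C D x \<iota> \<longleftrightarrow> is_cocone J C D x \<iota> \<and>
    (\<forall>y \<rho>. is_cocone J C D y \<rho> \<longrightarrow> (\<exists>!h. h \<in> hom C x y \<and> (\<forall>i \<in> Obj J. h \<cdot>\<^bsub>C\<^esub> \<iota> i = \<rho> i)))"

text \<open>Sets of cardinality less than the infinite cardinal \<open>\<kappa>\<close> are the small sets. A category with
  fewer than \<open>\<kappa> :: 'u rel\<close> arrows is isomorphic to one whose objects and arrows are elements
  of \<open>'u\<close>, so it suffices to take index categories of this type. If \<open>\<kappa>\<close> is inaccessible, these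
  are completeness and cocompleteness relative to the corresponding Grothendieck universe.\<close>

definition complete :: "'u rel \<Rightarrow> ('o, 'm) cat \<Rightarrow> bool" where
  "complete \<kappa> C \<longleftrightarrow> (\<forall>(J :: ('u, 'u) cat) D. |Arr J| <o \<kappa> \<and> is_functor J C D \<longrightarrow>
    (\<exists>x \<pi>. is_limit J C D x \<pi>))"

definition cocomplete :: "'u rel \<Rightarrow> ('o, 'm) cat \<Rightarrow> bool" where
  "cocomplete \<kappa> C \<longleftrightarrow> (\<forall>(J :: ('u, 'u) cat) D. |Arr J| <o \<kappa> \<and> is_functor J C D \<longrightarrow>
    (\<exists>x \<iota>. is_colimit J C D x \<iota>))"

definition locally_small :: "'v rel \<Rightarrow> ('o, 'm) cat \<Rightarrow> bool" where
  "locally_small \<mu> C \<longleftrightarrow> (\<forall>a \<in> Obj C. \<forall>b \<in> Obj C. |hom C a b| <o \<mu>)"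


section \<open>Model categories and left Quillen functors\<close>

definition has_lifting :: "('o, 'm) cat \<Rightarrow> 'm \<Rightarrow> 'm \<Rightarrow> bool" where
  "has_lifting C i p \<longleftrightarrow>
    (\<forall>u \<in> hom C (Dom C i) (Dom C p). \<forall>v \<in> hom C (Cod C i) (Cod C p).
      p \<cdot>\<^bsub>C\<^esub> u = v \<cdot>\<^bsub>C\<^esub> i \<longrightarrow>
      (\<exists>h \<in> hom C (Cod C i) (Dom C p). h \<cdot>\<^bsub>C\<^esub> i = u \<and> p \<cdot>\<^bsub>C\<^esub> h = v))"

definition weak_factorization_system :: "('o, 'm) cat \<Rightarrow> 'm set \<Rightarrow> 'm set \<Rightarrow> bool" where
  "weak_factorization_system C L R \<longleftrightarrow>
    L = {i \<in> Arr C. \<forall>p \<in> R. has_lifting C i p} \<and>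
    R = {p \<in> Arr C. \<forall>i \<in> L. has_lifting C i p} \<and>
    (\<forall>f \<in> Arr C. \<exists>i \<in> L. \<exists>p \<in> R. Cod C i = Dom C p \<and> f = p \<cdot>\<^bsub>C\<^esub> i)"

definition two_out_of_three :: "('o, 'm) cat \<Rightarrow> 'm set \<Rightarrow> bool" where
  "two_out_of_three C W \<longleftrightarrow>
    (\<forall>f \<in> Arr C. \<forall>g \<in> Arr C. Cod C f = Dom C g \<longrightarrow>
      (f \<in> W \<and> g \<in> W \<longrightarrow> g \<cdot>\<^bsub>C\<^esub> f \<in> W) \<and>
      (f \<in> W \<and> g \<cdot>\<^bsub>C\<^esub> f \<in> W \<longrightarrow> g \<in> W) \<and>
      (g \<in> W \<and> g \<cdot>\<^bsub>C\<^esub> f \<in> W \<longrightarrow> f \<in> W))"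

record ('o, 'm) model_cat =
  Und :: "('o, 'm) cat"
  Weq :: "'m set"
  Cof :: "'m set"
  Fib :: "'m set"

text \<open>The cardinal \<open>\<mu>\<close> bounds the hom-sets separately from the bound \<open>\<kappa>\<close> on diagrams. Taking
  \<open>\<mu> = \<kappa>\<close> gives the convention that categories are locally small; if \<open>\<mu>\<close> is larger than the
  cardinality of the type of arrows, there is no restriction on the hom-sets.\<close>

definition model_category :: "'u rel \<Rightarrow> 'v rel \<Rightarrow> ('o, 'm) model_cat \<Rightarrow> bool" where
  "model_category \<kappa> \<mu> M \<longleftrightarrow>
    category (Und M) \<and> locally_small \<mu> (Und M) \<and>
    complete \<kappa> (Und M) \<and> cocomplete \<kappa> (Und M) \<and>
    Weq M \<subseteq> Arr (Und M) \<and> Cof M \<subseteq> Arr (Und M) \<and> Fib M \<subseteq> Arr (Und M) \<and>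
    two_out_of_three (Und M) (Weq M) \<and>
    weak_factorization_system (Und M) (Cof M) (Fib M \<inter> Weq M) \<and>
    weak_factorization_system (Und M) (Cof M \<inter> Weq M) (Fib M)"

definition left_quillen :: "('o, 'm) model_cat \<Rightarrow> ('p, 'n) model_cat \<Rightarrow>
  ('o, 'm, 'p, 'n) ftor \<Rightarrow> bool" where
  "left_quillen M N F \<longleftrightarrow> left_adjoint (Und M) (Und N) F \<and>
    Far F ` Cof M \<subseteq> Cof N \<and> Far F ` (Cof M \<inter> Weq M) \<subseteq> Cof N \<inter> Weq N"

definition LQ :: "('o, 'm) model_cat \<Rightarrow> ('p, 'n) model_cat \<Rightarrow>
  (('o, 'm, 'p, 'n) ftor, ('o, 'm, 'p, 'n) ntrans) cat" where
  "LQ M N = full_subcategory (functor_category (Und M) (Und N)) (left_quillen M N)"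


section \<open>Bicategorical pullbacks of model categories\<close>

text \<open>The functor from \<open>LQ Z M\<close> to \<open>LQ Z N\<close> given by composition with the left Quillen functor
  \<open>L : M \<rightarrow> N\<close>.\<close>

definition LQ_postcomp :: "('z, 'y) model_cat \<Rightarrow> ('o, 'm) model_cat \<Rightarrow> ('o, 'm, 'p, 'n) ftor \<Rightarrow>
  (('z, 'y, 'o, 'm) ftor, ('z, 'y, 'o, 'm) ntrans,
   ('z, 'y, 'p, 'n) ftor, ('z, 'y, 'p, 'n) ntrans) ftor" where
  "LQ_postcomp Z M L = \<lparr>
    Fob = (\<lambda>F\<in>Obj (LQ Z M). comp_functor (Und Z) L F),
    Far = (\<lambda>(F, G, \<tau>)\<in>Arr (LQ Z M).
      (comp_functor (Und Z) L F, comp_functor (Und Z) L G, whisker_left (Und Z) L \<tau>))\<rparr>"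

definition LQ_pseudopullback where
  "LQ_pseudopullback Z M1 M2 M3 L1 L2 =
    pseudopullback (LQ Z M1) (LQ Z M2) (LQ Z M3) (LQ_postcomp Z M1 L1) (LQ_postcomp Z M2 L2)"

text \<open>The functor from \<open>LQ Z M0\<close> to this pseudopullback induced by a square of left Quillen functors
  commuting up to the isomorphism \<open>\<phi> : L1 P1 \<cong> L2 P2\<close>. It sends \<open>F\<close> to \<open>(P1 F, P2 F, \<phi> F)\<close>.\<close>

definition induced_object where
  "induced_object Z M0 L1 L2 P1 P2 \<phi> F =
    (comp_functor (Und Z) P1 F, comp_functor (Und Z) P2 F,
      (comp_functor (Und Z) (comp_functor (Und M0) L1 P1) F,
       comp_functor (Und Z) (comp_functor (Und M0) L2 P2) F,
       whisker_right (Und Z) \<phi> F))"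

definition induced_functor where
  "induced_functor Z M0 M1 M2 L1 L2 P1 P2 \<phi> = \<lparr>
    Fob = (\<lambda>F\<in>Obj (LQ Z M0). induced_object Z M0 L1 L2 P1 P2 \<phi> F),
    Far = (\<lambda>(F, G, \<tau>)\<in>Arr (LQ Z M0).
      (induced_object Z M0 L1 L2 P1 P2 \<phi> F, induced_object Z M0 L1 L2 P1 P2 \<phi> G,
       (Far (LQ_postcomp Z M0 P1) (F, G, \<tau>), Far (LQ_postcomp Z M0 P2) (F, G, \<tau>))))\<rparr>"

text \<open>The square (\<open>M0\<close>, \<open>P1\<close>, \<open>P2\<close>, \<open>\<phi>\<close>) is a bilimit of \<open>L1 : M1 \<rightarrow> M3\<close> and \<open>L2 : M2 \<rightarrow> M3\<close>
  in the 2-category of model categories. The objects of this 2-category are the model categories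
  with objects in \<open>'o\<close> and arrows in \<open>'m\<close>; they form the ambient class of large categories over which
  the test object \<open>Z\<close> ranges.\<close>

definition is_pullback ::
  "'u rel \<Rightarrow> 'v rel \<Rightarrow>
   ('o, 'm) model_cat \<Rightarrow> ('o, 'm) model_cat \<Rightarrow> ('o, 'm) model_cat \<Rightarrow>
   ('o, 'm, 'o, 'm) ftor \<Rightarrow> ('o, 'm, 'o, 'm) ftor \<Rightarrow>
   ('o, 'm) model_cat \<Rightarrow> ('o, 'm, 'o, 'm) ftor \<Rightarrow> ('o, 'm, 'o, 'm) ftor \<Rightarrow> ('o \<Rightarrow> 'm) \<Rightarrow> bool" where
  "is_pullback \<kappa> \<mu> M1 M2 M3 L1 L2 M0 P1 P2 \<phi> \<longleftrightarrow>
    model_category \<kappa> \<mu> M0 \<and> left_quillen M0 M1 P1 \<and> left_quillen M0 M2 P2 \<and>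
    nat_iso (Und M0) (Und M3) (comp_functor (Und M0) L1 P1) (comp_functor (Und M0) L2 P2) \<phi> \<and>
    (\<forall>Z :: ('o, 'm) model_cat. model_category \<kappa> \<mu> Z \<longrightarrow>
      is_equivalence (LQ Z M0) (LQ_pseudopullback Z M1 M2 M3 L1 L2)
        (induced_functor Z M0 M1 M2 L1 L2 P1 P2 \<phi>))"

end

theory Submission
  imports Defs
begin

text \<open>Every category underlying a model category carries a minimal model structure: all maps are
  weak equivalences and fibrations, and only the isomorphisms are cofibrations. A left Quillen functor
  out of it is nothing but a left adjoint (\<open>left_quillen_minimal\<close>). Testing the universal property
  of \<open>M0\<close> against these structures therefore forgets the model structures of \<open>M1\<close>, \<open>M2\<close> and
  \<open>M3\<close>, and says that \<open>Und M0\<close> is a pullback of two identity functors of \<open>M\<close> in the 2-category of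
  categories and left adjoints, tested on all categories that underlie model categories. Such a
  pullback is \<open>M\<close> itself, by the usual uniqueness argument for bilimits, applied to two test objects:

  \<^item> For the minimal structure on \<open>M\<close>, the triple of identities is an object of the
    pseudopullback. Essential surjectivity gives a left adjoint \<open>E : M \<rightarrow> Und M0\<close> and isomorphisms
    \<open>\<alpha> : P1 E \<cong> 1\<close> and \<open>\<beta> : P2 E \<cong> 1\<close> with \<open>\<beta> \<cdot> \<phi>E = \<alpha>\<close>.
  \<^item> For the minimal structure on \<open>Und M0\<close>, the left adjoints \<open>E P1\<close> and \<open>1\<close> have isomorphic
    images in the pseudopullback, via \<open>\<alpha>P1 : P1 E P1 \<cong> P1\<close> and
    \<open>\<phi> \<cdot> \<beta>P1 : P2 E P1 \<cong> P1 \<cong> P2\<close>. Equivalences reflect isomorphism, so \<open>E P1 \<cong> 1\<close>.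

  Hence \<open>E\<close> is an equivalence with quasi-inverse \<open>P1\<close>. Two facts make these objects and arrows
  legitimate: left adjoints compose (\<open>left_adjoint_comp\<close>), so that \<open>E P1\<close> is an object of the category
  of left Quillen functors; and invertibility in categories of left Quillen functors and in
  pseudopullbacks can be tested on components (\<open>LQ_iso_iff\<close>, \<open>pseudopullback_isomorphicI\<close>,
  \<open>pseudopullback_isomorphicE\<close>).\<close>

section \<open>Isomorphisms and functors\<close>

lemma homD:
  assumes "f \<in> hom C a b"
  shows "f \<in> Arr C" "Dom C f = a" "Cod C f = b"
  using assms by (auto simp: hom_def)

lemma isoE:
  assumes "iso C f" "f \<in> hom C a b"
  obtains g where "g \<in> hom C b a" "g \<cdot>\<^bsub>C\<^esub> f = Id C a" "f \<cdot>\<^bsub>C\<^esub> g = Id C b"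
  using assms by (auto simp: iso_def hom_def)

lemma isoI:
  assumes "f \<in> hom C a b" "g \<in> hom C b a" "g \<cdot>\<^bsub>C\<^esub> f = Id C a" "f \<cdot>\<^bsub>C\<^esub> g = Id C b"
  shows "iso C f"
  using assms by (auto simp: iso_def hom_def)

definition isomorphic_objects :: "('o, 'm) cat \<Rightarrow> 'o \<Rightarrow> 'o \<Rightarrow> bool" where
  "isomorphic_objects C a b \<longleftrightarrow> (\<exists>f \<in> hom C a b. iso C f)"

context category
begin

lemma hom_Obj:
  assumes "f \<in> hom C a b"
  shows "a \<in> Obj C" "b \<in> Obj C"
  using assms Dom_in_Obj Cod_in_Obj by (auto simp: hom_def)

lemma iso_Id: "a \<in> Obj C \<Longrightarrow> iso C (Id C a)"
  using Id_in_hom Comp_Id by (intro isoI[of _ C a a]) auto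

lemma Comp_middle_cancel:
  assumes f: "f \<in> hom C a b" and g: "g \<in> hom C b c" and h: "h \<in> hom C c b"
    and k: "k \<in> hom C b d" and hg: "h \<cdot> g = Id C b"
  shows "(k \<cdot> h) \<cdot> (g \<cdot> f) = k \<cdot> f"
  using Comp_assoc[OF Comp_in_hom[OF f g] h k] Comp_assoc[OF f g h] hg Id_Comp[OF f] by simp

lemma iso_Comp:
  assumes f: "f \<in> hom C a b" "iso C f" and g: "g \<in> hom C b c" "iso C g"
  shows "iso C (g \<cdot> f)"
proof -
  obtain f' where f': "f' \<in> hom C b a" "f' \<cdot> f = Id C a" "f \<cdot> f' = Id C b"
    using isoE[OF f(2,1)] .
  obtain g' where g': "g' \<in> hom C c b" "g' \<cdot> g = Id C b" "g \<cdot> g' = Id C c"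
    using isoE[OF g(2,1)] .
  show ?thesis
  proof (rule isoI[of _ C a c "f' \<cdot> g'"])
    show "g \<cdot> f \<in> hom C a c" "f' \<cdot> g' \<in> hom C c a"
      using Comp_in_hom[OF f(1) g(1)] Comp_in_hom[OF g'(1) f'(1)] .
    show "(f' \<cdot> g') \<cdot> (g \<cdot> f) = Id C a" "(g \<cdot> f) \<cdot> (f' \<cdot> g') = Id C c"
      using Comp_middle_cancel[OF f(1) g(1) g'(1) f'(1) g'(2)]
        Comp_middle_cancel[OF g'(1) f'(1) f(1) g(1) f'(3)] f'(2) g'(3) by simp_all
  qed
qed

text \<open>The square behind naturality of componentwise inverses, and behind compatibility of the
  inverse of an arrow of a pseudopullback.\<close>

lemma square_inverse:
  assumes p: "p \<in> hom C a b" "p' \<in> hom C b a" "p \<cdot> p' = Id C b"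
    and q: "q \<in> hom C c d" "q' \<in> hom C d c" "q' \<cdot> q = Id C c"
    and u: "u \<in> hom C a c" and v: "v \<in> hom C b d" and square: "q \<cdot> u = v \<cdot> p"
  shows "q' \<cdot> v = u \<cdot> p'"
proof -
  note up' = Comp_in_hom[OF p(2) u]
  have "q' \<cdot> v = q' \<cdot> ((v \<cdot> p) \<cdot> p')"
    using Comp_assoc[OF p(2,1) v] p(3) Comp_Id[OF v] by simp
  also have "\<dots> = q' \<cdot> (q \<cdot> (u \<cdot> p'))"
    using Comp_assoc[OF p(2) u q(1)] square by simp
  also have "\<dots> = u \<cdot> p'"
    using Comp_assoc[OF up' q(1,2)] q(3) Id_Comp[OF up'] by simp
  finally show ?thesis .
qed

lemma isomorphic_objects_sym: "isomorphic_objects C a b \<Longrightarrow> isomorphic_objects C b a"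
  unfolding isomorphic_objects_def by (metis isoE isoI)

lemma isomorphic_objects_trans:
  "isomorphic_objects C a b \<Longrightarrow> isomorphic_objects C b c \<Longrightarrow> isomorphic_objects C a c"
  unfolding isomorphic_objects_def using iso_Comp Comp_in_hom by blast

end

lemma functor_category_source: "is_functor C D F \<Longrightarrow> category C"
  and functor_category_target: "is_functor C D F \<Longrightarrow> category D"
  by (auto simp: is_functor_def)

lemma functor_Obj: "is_functor C D F \<Longrightarrow> a \<in> Obj C \<Longrightarrow> Fob F a \<in> Obj D"
  by (auto simp: is_functor_def)

lemma functor_hom:
  "is_functor C D F \<Longrightarrow> f \<in> hom C a b \<Longrightarrow> Far F f \<in> hom D (Fob F a) (Fob F b)"
  by (auto simp: is_functor_def hom_def)

lemma functor_Id: "is_functor C D F \<Longrightarrow> a \<in> Obj C \<Longrightarrow> Far F (Id C a) = Id D (Fob F a)"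
  by (auto simp: is_functor_def)

lemma functor_Comp:
  "is_functor C D F \<Longrightarrow> f \<in> hom C a b \<Longrightarrow> g \<in> hom C b c \<Longrightarrow>
    Far F (g \<cdot>\<^bsub>C\<^esub> f) = Far F g \<cdot>\<^bsub>D\<^esub> Far F f"
  by (auto simp: is_functor_def hom_def)

lemma functor_iso:
  assumes F: "is_functor C D F" and f: "f \<in> hom C a b" "iso C f"
  shows "iso D (Far F f)"
proof -
  interpret category C by (rule functor_category_source[OF F])
  obtain g where g: "g \<in> hom C b a" "g \<cdot>\<^bsub>C\<^esub> f = Id C a" "f \<cdot>\<^bsub>C\<^esub> g = Id C b"
    using isoE[OF f(2,1)] .
  show ?thesis
    using isoI[OF functor_hom[OF F f(1)] functor_hom[OF F g(1)]]
      functor_Comp[OF F f(1) g(1)] functor_Comp[OF F g(1) f(1)] g(2,3)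
      functor_Id[OF F] hom_Obj[OF f(1)] by metis
qed

lemma is_functorI:
  assumes "category C" "category D" "Fob F \<in> extensional (Obj C)" "Far F \<in> extensional (Arr C)"
    and "\<And>a. a \<in> Obj C \<Longrightarrow> Fob F a \<in> Obj D"
    and hom: "\<And>f a b. f \<in> hom C a b \<Longrightarrow> Far F f \<in> hom D (Fob F a) (Fob F b)"
    and "\<And>a. a \<in> Obj C \<Longrightarrow> Far F (Id C a) = Id D (Fob F a)"
    and Comp: "\<And>f g a b c. f \<in> hom C a b \<Longrightarrow> g \<in> hom C b c \<Longrightarrow>
      Far F (g \<cdot>\<^bsub>C\<^esub> f) = Far F g \<cdot>\<^bsub>D\<^esub> Far F f"
  shows "is_functor C D F"
proof -
  have "Far F f \<in> hom D (Fob F (Dom C f)) (Fob F (Cod C f))" if "f \<in> Arr C" for f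
    using hom[of f] that by (simp add: hom_def)
  moreover have "Far F (g \<cdot>\<^bsub>C\<^esub> f) = Far F g \<cdot>\<^bsub>D\<^esub> Far F f"
    if "f \<in> Arr C" "g \<in> Arr C" "Cod C f = Dom C g" for f g
    using Comp[of f "Dom C f" "Cod C f" g] that by (simp add: hom_def)
  ultimately show ?thesis
    using assms unfolding is_functor_def by (simp add: PiE_def Pi_def hom_def)
qed

lemma id_functor_simps [simp]:
  "a \<in> Obj C \<Longrightarrow> Fob (id_functor C) a = a"
  "f \<in> Arr C \<Longrightarrow> Far (id_functor C) f = f"
  by (auto simp: id_functor_def)

lemma comp_functor_Fob [simp]:
  "a \<in> Obj C \<Longrightarrow> Fob (comp_functor C G F) a = Fob G (Fob F a)"
  by (simp add: comp_functor_def)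

lemma comp_functor_Far [simp]:
  "f \<in> Arr C \<Longrightarrow> Far (comp_functor C G F) f = Far G (Far F f)"
  by (simp add: comp_functor_def)

lemma is_functor_id:
  assumes "category C"
  shows "is_functor C C (id_functor C)"
proof -
  interpret category C by (rule assms)
  show ?thesis
  proof (rule is_functorI)
    show "Far (id_functor C) f \<in> hom C (Fob (id_functor C) a) (Fob (id_functor C) b)"
      if "f \<in> hom C a b" for f a b
      using that hom_Obj[OF that] homD[OF that] by simp
    show "Far (id_functor C) (g \<cdot>\<^bsub>C\<^esub> f) = Far (id_functor C) g \<cdot>\<^bsub>C\<^esub> Far (id_functor C) f"
      if "f \<in> hom C a b" "g \<in> hom C b c" for f g a b c
      using homD(1) that Comp_in_hom[OF that] by (metis id_functor_simps(2))
  qed (use assms in \<open>auto simp: id_functor_def intro: homD(1) Id_in_hom\<close>)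
qed

lemma is_functor_comp:
  assumes F: "is_functor C D F" and G: "is_functor D E G"
  shows "is_functor C E (comp_functor C G F)"
proof -
  interpret category C by (rule functor_category_source[OF F])
  show ?thesis
  proof (rule is_functorI)
    show "Far (comp_functor C G F) f \<in> hom E (Fob (comp_functor C G F) a) (Fob (comp_functor C G F) b)"
      if "f \<in> hom C a b" for f a b
      using functor_hom[OF G functor_hom[OF F that]] hom_Obj[OF that] homD[OF that] by simp
    show "Far (comp_functor C G F) (g \<cdot>\<^bsub>C\<^esub> f) =
        Far (comp_functor C G F) g \<cdot>\<^bsub>E\<^esub> Far (comp_functor C G F) f"
      if "f \<in> hom C a b" "g \<in> hom C b c" for f g a b c
      using functor_Comp[OF G functor_hom[OF F that(1)] functor_hom[OF F that(2)]]
        functor_Comp[OF F that] homD(1)[OF that(1)] homD(1)[OF that(2)]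
        homD(1)[OF Comp_in_hom[OF that]] by simp
    show "Far (comp_functor C G F) (Id C a) = Id E (Fob (comp_functor C G F) a)"
      if "a \<in> Obj C" for a
      using that homD(1)[OF Id_in_hom] functor_Id[OF F] functor_Id[OF G] functor_Obj[OF F] by simp
  qed (use functor_category_source[OF F] functor_category_target[OF G] functor_Obj[OF F]
      functor_Obj[OF G] in \<open>auto simp: comp_functor_def\<close>)
qed

lemma ftor_eqI:
  assumes "is_functor C D F" "is_functor C D G"
    and "\<And>a. a \<in> Obj C \<Longrightarrow> Fob F a = Fob G a" "\<And>f. f \<in> Arr C \<Longrightarrow> Far F f = Far G f"
  shows "F = G"
proof -
  have "Fob F = Fob G"
    using assms by (intro extensionalityI[of _ "Obj C"]) (auto simp: is_functor_def PiE_def)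
  moreover have "Far F = Far G"
    using assms by (intro extensionalityI[of _ "Arr C"]) (auto simp: is_functor_def PiE_def)
  ultimately show ?thesis by (cases F; cases G) simp
qed

lemma comp_functor_id_left:
  assumes F: "is_functor C D F"
  shows "comp_functor C (id_functor D) F = F"
proof (rule ftor_eqI)
  show "is_functor C D (comp_functor C (id_functor D) F)"
    using is_functor_comp[OF F is_functor_id[OF functor_category_target[OF F]]] .
qed (use F in \<open>auto simp: is_functor_def PiE_def Pi_def\<close>)

lemma comp_functor_id_right:
  assumes F: "is_functor C D F"
  shows "comp_functor C F (id_functor C) = F"
proof (rule ftor_eqI)
  show "is_functor C D (comp_functor C F (id_functor C))"
    using is_functor_comp[OF is_functor_id[OF functor_category_source[OF F]] F] .
qed (use F in auto)

lemma comp_functor_assoc: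
  assumes F: "is_functor C D F"
  shows "comp_functor C (comp_functor D H G) F = comp_functor C H (comp_functor C G F)"
  using F by (auto simp: comp_functor_def is_functor_def PiE_def Pi_def intro!: restrict_ext)

section \<open>Natural transformations\<close>

lemma nat_trans_functors:
  assumes "nat_trans C D F G \<tau>"
  shows "is_functor C D F" "is_functor C D G"
  using assms by (auto simp: nat_trans_def)

lemma nat_trans_hom: "nat_trans C D F G \<tau> \<Longrightarrow> a \<in> Obj C \<Longrightarrow> \<tau> a \<in> hom D (Fob F a) (Fob G a)"
  by (auto simp: nat_trans_def)

lemma nat_trans_square:
  "nat_trans C D F G \<tau> \<Longrightarrow> f \<in> hom C a b \<Longrightarrow> \<tau> b \<cdot>\<^bsub>D\<^esub> Far F f = Far G f \<cdot>\<^bsub>D\<^esub> \<tau> a"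
  by (auto simp: nat_trans_def hom_def)

lemma nat_transI:
  assumes "is_functor C D F" "is_functor C D G" "\<tau> \<in> extensional (Obj C)"
    and "\<And>a. a \<in> Obj C \<Longrightarrow> \<tau> a \<in> hom D (Fob F a) (Fob G a)"
    and "\<And>f a b. f \<in> hom C a b \<Longrightarrow> a \<in> Obj C \<Longrightarrow> b \<in> Obj C \<Longrightarrow>
      \<tau> b \<cdot>\<^bsub>D\<^esub> Far F f = Far G f \<cdot>\<^bsub>D\<^esub> \<tau> a"
  shows "nat_trans C D F G \<tau>"
proof -
  interpret category C by (rule functor_category_source[OF assms(1)])
  show ?thesis
    using assms Dom_in_Obj Cod_in_Obj by (auto simp: nat_trans_def hom_def)
qed

lemma nat_trans_id:
  assumes F: "is_functor C D F"
  shows "nat_trans C D F F (\<lambda>a\<in>Obj C. Id D (Fob F a))"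
proof -
  interpret D: category D by (rule functor_category_target[OF F])
  show ?thesis
    using F functor_Obj[OF F] D.Id_Comp[OF functor_hom[OF F]] D.Comp_Id[OF functor_hom[OF F]]
    by (intro nat_transI) (auto simp: D.Id_in_hom)
qed

lemma nat_trans_vcomp:
  assumes \<tau>: "nat_trans C D F G \<tau>" and \<sigma>: "nat_trans C D G H \<sigma>"
  shows "nat_trans C D F H (\<lambda>a\<in>Obj C. \<sigma> a \<cdot>\<^bsub>D\<^esub> \<tau> a)"
proof -
  interpret D: category D by (rule functor_category_target[OF nat_trans_functors(1)[OF \<tau>]])
  show ?thesis
  proof (rule nat_transI)
    fix f a b assume f: "f \<in> hom C a b" and ab: "a \<in> Obj C" "b \<in> Obj C"
    note t = nat_trans_hom[OF \<tau>] and s = nat_trans_hom[OF \<sigma>]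
      and Ff = functor_hom[OF nat_trans_functors(1)[OF \<tau>] f]
      and Gf = functor_hom[OF nat_trans_functors(2)[OF \<tau>] f]
      and Hf = functor_hom[OF nat_trans_functors(2)[OF \<sigma>] f]
    have "(\<sigma> b \<cdot>\<^bsub>D\<^esub> \<tau> b) \<cdot>\<^bsub>D\<^esub> Far F f = \<sigma> b \<cdot>\<^bsub>D\<^esub> (Far G f \<cdot>\<^bsub>D\<^esub> \<tau> a)"
      using D.Comp_assoc[OF Ff t[OF ab(2)] s[OF ab(2)]] nat_trans_square[OF \<tau> f] by simp
    also have "\<dots> = (Far H f \<cdot>\<^bsub>D\<^esub> \<sigma> a) \<cdot>\<^bsub>D\<^esub> \<tau> a"
      using D.Comp_assoc[OF t[OF ab(1)] Gf s[OF ab(2)]] nat_trans_square[OF \<sigma> f] by simp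
    also have "\<dots> = Far H f \<cdot>\<^bsub>D\<^esub> (\<sigma> a \<cdot>\<^bsub>D\<^esub> \<tau> a)"
      using D.Comp_assoc[OF t[OF ab(1)] s[OF ab(1)] Hf] .
    finally show "(\<lambda>a\<in>Obj C. \<sigma> a \<cdot>\<^bsub>D\<^esub> \<tau> a) b \<cdot>\<^bsub>D\<^esub> Far F f =
        Far H f \<cdot>\<^bsub>D\<^esub> (\<lambda>a\<in>Obj C. \<sigma> a \<cdot>\<^bsub>D\<^esub> \<tau> a) a"
      using ab by simp
  qed (use nat_trans_functors[OF \<tau>] nat_trans_functors[OF \<sigma>]
      D.Comp_in_hom[OF nat_trans_hom[OF \<tau>] nat_trans_hom[OF \<sigma>]] in auto)
qed

lemma nat_trans_whisker_left:
  assumes \<tau>: "nat_trans C D F G \<tau>" and L: "is_functor D E L"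
  shows "nat_trans C E (comp_functor C L F) (comp_functor C L G) (whisker_left C L \<tau>)"
proof (rule nat_transI)
  fix f a b assume f: "f \<in> hom C a b" and ab: "a \<in> Obj C" "b \<in> Obj C"
  note t = nat_trans_hom[OF \<tau>]
    and Ff = functor_hom[OF nat_trans_functors(1)[OF \<tau>] f]
    and Gf = functor_hom[OF nat_trans_functors(2)[OF \<tau>] f]
  show "whisker_left C L \<tau> b \<cdot>\<^bsub>E\<^esub> Far (comp_functor C L F) f =
      Far (comp_functor C L G) f \<cdot>\<^bsub>E\<^esub> whisker_left C L \<tau> a"
    using functor_Comp[OF L Ff t[OF ab(2)]] functor_Comp[OF L t[OF ab(1)] Gf]
      nat_trans_square[OF \<tau> f] ab homD(1)[OF f] by (simp add: whisker_left_def)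
qed (use is_functor_comp[OF _ L] nat_trans_functors[OF \<tau>] nat_trans_hom[OF \<tau>] functor_hom[OF L]
    in \<open>auto simp: whisker_left_def\<close>)

lemma nat_trans_whisker_right:
  assumes \<tau>: "nat_trans D E F G \<tau>" and H: "is_functor C D H"
  shows "nat_trans C E (comp_functor C F H) (comp_functor C G H) (whisker_right C \<tau> H)"
proof (rule nat_transI)
  fix f a b assume f: "f \<in> hom C a b" and ab: "a \<in> Obj C" "b \<in> Obj C"
  show "whisker_right C \<tau> H b \<cdot>\<^bsub>E\<^esub> Far (comp_functor C F H) f =
      Far (comp_functor C G H) f \<cdot>\<^bsub>E\<^esub> whisker_right C \<tau> H a"
    using nat_trans_square[OF \<tau> functor_hom[OF H f]] ab homD(1)[OF f]
    by (simp add: whisker_right_def)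
qed (use is_functor_comp[OF H] nat_trans_functors[OF \<tau>] nat_trans_hom[OF \<tau>] functor_Obj[OF H]
    in \<open>auto simp: whisker_right_def\<close>)

lemma nat_iso_vcomp:
  assumes \<tau>: "nat_iso C D F G \<tau>" and \<sigma>: "nat_iso C D G H \<sigma>"
  shows "nat_iso C D F H (\<lambda>a\<in>Obj C. \<sigma> a \<cdot>\<^bsub>D\<^esub> \<tau> a)"
proof -
  have nt: "nat_trans C D F G \<tau>" "nat_trans C D G H \<sigma>"
    using assms by (auto simp: nat_iso_def)
  interpret D: category D by (rule functor_category_target[OF nat_trans_functors(1)[OF nt(1)]])
  show ?thesis
    using nat_trans_vcomp[OF nt] D.iso_Comp[OF nat_trans_hom[OF nt(1)] _ nat_trans_hom[OF nt(2)]]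
      assms by (auto simp: nat_iso_def)
qed

lemma nat_iso_whisker_right:
  assumes \<tau>: "nat_iso D E F G \<tau>" and H: "is_functor C D H"
  shows "nat_iso C E (comp_functor C F H) (comp_functor C G H) (whisker_right C \<tau> H)"
  using assms nat_trans_whisker_right[of D E F G \<tau> C H] functor_Obj[OF H]
  by (auto simp: nat_iso_def whisker_right_def)

lemma isomorphic_functorsI: "nat_iso C D F G \<tau> \<Longrightarrow> isomorphic_functors C D F G"
  by (auto simp: isomorphic_functors_def)

lemma nat_iso_inverse:
  assumes \<tau>: "nat_iso C D F G \<tau>"
  obtains \<sigma> where "nat_trans C D G F \<sigma>"
    "\<And>a. a \<in> Obj C \<Longrightarrow> \<sigma> a \<cdot>\<^bsub>D\<^esub> \<tau> a = Id D (Fob F a)"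
    "\<And>a. a \<in> Obj C \<Longrightarrow> \<tau> a \<cdot>\<^bsub>D\<^esub> \<sigma> a = Id D (Fob G a)"
proof -
  have nt: "nat_trans C D F G \<tau>" using \<tau> by (simp add: nat_iso_def)
  note F = nat_trans_functors(1)[OF nt] and G = nat_trans_functors(2)[OF nt]
  interpret D: category D by (rule functor_category_target[OF F])
  have "\<forall>a\<in>Obj C. \<exists>s. s \<in> hom D (Fob G a) (Fob F a) \<and>
      s \<cdot>\<^bsub>D\<^esub> \<tau> a = Id D (Fob F a) \<and> \<tau> a \<cdot>\<^bsub>D\<^esub> s = Id D (Fob G a)"
    using \<tau> nat_trans_hom[OF nt] isoE unfolding nat_iso_def by metis
  then obtain s where s: "\<And>a. a \<in> Obj C \<Longrightarrow> s a \<in> hom D (Fob G a) (Fob F a)"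
    "\<And>a. a \<in> Obj C \<Longrightarrow> s a \<cdot>\<^bsub>D\<^esub> \<tau> a = Id D (Fob F a)"
    "\<And>a. a \<in> Obj C \<Longrightarrow> \<tau> a \<cdot>\<^bsub>D\<^esub> s a = Id D (Fob G a)"
    by metis
  have "nat_trans C D G F (restrict s (Obj C))"
  proof (rule nat_transI)
    fix f a b assume f: "f \<in> hom C a b" and ab: "a \<in> Obj C" "b \<in> Obj C"
    show "restrict s (Obj C) b \<cdot>\<^bsub>D\<^esub> Far G f = Far F f \<cdot>\<^bsub>D\<^esub> restrict s (Obj C) a"
      using D.square_inverse[OF nat_trans_hom[OF nt ab(1)] s(1)[OF ab(1)] s(3)[OF ab(1)]
          nat_trans_hom[OF nt ab(2)] s(1)[OF ab(2)] s(2)[OF ab(2)]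
          functor_hom[OF F f] functor_hom[OF G f] nat_trans_square[OF nt f]] ab
      by simp
  qed (use F G s in auto)
  with s show ?thesis by (intro that[of "restrict s (Obj C)"]) auto
qed

section \<open>Equivalences and adjunctions\<close>

text \<open>An equivalence reflects isomorphism of objects because it has a quasi-inverse \<open>G\<close>:
  \<open>a \<cong> G K a \<cong> G K b \<cong> b\<close>.\<close>

lemma equivalence_reflects_isomorphic:
  assumes K: "is_equivalence C D K" and ab: "a \<in> Obj C" "b \<in> Obj C"
    and iso: "isomorphic_objects D (Fob K a) (Fob K b)"
  shows "isomorphic_objects C a b"
proof -
  obtain G \<tau> where G: "is_functor D C G"
    and \<tau>: "nat_iso C C (comp_functor C G K) (id_functor C) \<tau>"
    using K by (auto simp: is_equivalence_def isomorphic_functors_def)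
  interpret category C by (rule functor_category_target[OF G])
  have unit: "isomorphic_objects C (Fob G (Fob K x)) x" if "x \<in> Obj C" for x
    using \<tau> that nat_trans_hom[of C C "comp_functor C G K" "id_functor C" \<tau> x]
    by (auto simp: nat_iso_def isomorphic_objects_def)
  have "isomorphic_objects C (Fob G (Fob K a)) (Fob G (Fob K b))"
    using iso functor_hom[OF G] functor_iso[OF G] unfolding isomorphic_objects_def by blast
  with unit ab show ?thesis
    using isomorphic_objects_sym isomorphic_objects_trans by metis
qed

lemma equivalence_essentially_surjective:
  assumes K: "is_equivalence C D K" and d: "d \<in> Obj D"
  obtains a where "a \<in> Obj C" "isomorphic_objects D (Fob K a) d"
proof -
  obtain G \<tau> where G: "is_functor D C G"
    and \<tau>: "nat_iso D D (comp_functor D K G) (id_functor D) \<tau>"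
    using K by (auto simp: is_equivalence_def isomorphic_functors_def)
  have "isomorphic_objects D (Fob K (Fob G d)) d"
    using \<tau> d nat_trans_hom[of D D "comp_functor D K G" "id_functor D" \<tau> d]
    by (auto simp: nat_iso_def isomorphic_objects_def)
  with that functor_Obj[OF G d] show thesis by blast
qed

lemma left_adjoint_functor: "left_adjoint C D F \<Longrightarrow> is_functor C D F"
  by (simp add: left_adjoint_def)

lemma left_adjointI:
  assumes "is_functor C D F" "is_functor D C G"
    and "nat_trans C C (id_functor C) (comp_functor C G F) \<eta>"
    and "nat_trans D D (comp_functor D F G) (id_functor D) \<epsilon>"
    and "\<And>a. a \<in> Obj C \<Longrightarrow> \<epsilon> (Fob F a) \<cdot>\<^bsub>D\<^esub> Far F (\<eta> a) = Id D (Fob F a)"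
    and "\<And>b. b \<in> Obj D \<Longrightarrow> Far G (\<epsilon> b) \<cdot>\<^bsub>C\<^esub> \<eta> (Fob G b) = Id C (Fob G b)"
  shows "left_adjoint C D F"
  using assms unfolding left_adjoint_def by blast

lemma left_adjoint_id:
  assumes C: "category C"
  shows "left_adjoint C C (id_functor C)"
proof -
  interpret category C by (rule C)
  let ?i = "\<lambda>a\<in>Obj C. Id C a"
  note I = is_functor_id[OF C]
  have "nat_trans C C (id_functor C) (id_functor C) ?i"
    using nat_trans_id[OF I] by (simp cong: restrict_cong)
  moreover have "Id C a \<in> Arr C" "Id C a \<cdot>\<^bsub>C\<^esub> Id C a = Id C a" if "a \<in> Obj C" for a
    using Id_in_hom[OF that] Comp_Id homD(1) by auto
  ultimately show ?thesis
    unfolding left_adjoint_def using I comp_functor_id_left[OF I]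
    by (intro conjI exI[of _ "id_functor C"] exI[of _ ?i]) auto
qed

text \<open>For \<open>F \<stileturn> G\<close> and \<open>F' \<stileturn> G'\<close> the unit and counit of \<open>F' F \<stileturn> G G'\<close> are the
  composites \<open>1 \<rightarrow> G F \<rightarrow> G G' F' F\<close> and \<open>F' F G G' \<rightarrow> F' G' \<rightarrow> 1\<close>. Naturality of the inner
  counit (unit) reduces each triangle identity to the ones of the two given adjunctions.\<close>

lemma left_adjoint_comp:
  assumes "left_adjoint C D F" "left_adjoint D E F'"
  shows "left_adjoint C E (comp_functor C F' F)"
proof -
  obtain G \<eta> \<epsilon> where F: "is_functor C D F" and G: "is_functor D C G"
    and \<eta>: "nat_trans C C (id_functor C) (comp_functor C G F) \<eta>"
    and \<epsilon>: "nat_trans D D (comp_functor D F G) (id_functor D) \<epsilon>"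
    and tri1: "\<And>a. a \<in> Obj C \<Longrightarrow> \<epsilon> (Fob F a) \<cdot>\<^bsub>D\<^esub> Far F (\<eta> a) = Id D (Fob F a)"
    and tri2: "\<And>b. b \<in> Obj D \<Longrightarrow> Far G (\<epsilon> b) \<cdot>\<^bsub>C\<^esub> \<eta> (Fob G b) = Id C (Fob G b)"
    using assms(1) by (auto simp: left_adjoint_def)
  obtain G' \<eta>' \<epsilon>' where F': "is_functor D E F'" and G': "is_functor E D G'"
    and \<eta>': "nat_trans D D (id_functor D) (comp_functor D G' F') \<eta>'"
    and \<epsilon>': "nat_trans E E (comp_functor E F' G') (id_functor E) \<epsilon>'"
    and tri1': "\<And>a. a \<in> Obj D \<Longrightarrow> \<epsilon>' (Fob F' a) \<cdot>\<^bsub>E\<^esub> Far F' (\<eta>' a) = Id E (Fob F' a)"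
    and tri2': "\<And>b. b \<in> Obj E \<Longrightarrow> Far G' (\<epsilon>' b) \<cdot>\<^bsub>D\<^esub> \<eta>' (Fob G' b) = Id D (Fob G' b)"
    using assms(2) by (auto simp: left_adjoint_def)
  interpret C: category C by (rule functor_category_source[OF F])
  interpret D: category D by (rule functor_category_target[OF F])
  interpret E: category E by (rule functor_category_target[OF F'])
  note FF' = is_functor_comp[OF F F'] and GG' = is_functor_comp[OF G' G]

  define \<eta>'' where "\<eta>'' = (\<lambda>a\<in>Obj C. Far G (\<eta>' (Fob F a)) \<cdot>\<^bsub>C\<^esub> \<eta> a)"
  define \<epsilon>'' where "\<epsilon>'' = (\<lambda>b\<in>Obj E. \<epsilon>' b \<cdot>\<^bsub>E\<^esub> Far F' (\<epsilon> (Fob G' b)))"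
  have unit: "nat_trans C C (id_functor C)
      (comp_functor C (comp_functor E G G') (comp_functor C F' F)) \<eta>''"
  proof -
    let ?s = "whisker_right C (whisker_left D G \<eta>') F"
    have "nat_trans C C (comp_functor C (comp_functor D G (id_functor D)) F)
        (comp_functor C (comp_functor D G (comp_functor D G' F')) F) ?s"
      by (rule nat_trans_whisker_right[OF nat_trans_whisker_left[OF \<eta>' G] F])
    then have "nat_trans C C (comp_functor C G F)
        (comp_functor C (comp_functor E G G') (comp_functor C F' F)) ?s"
      by (simp add: comp_functor_id_right[OF G] comp_functor_assoc[OF F] comp_functor_assoc[OF FF'])
    from nat_trans_vcomp[OF \<eta> this] show ?thesis
      using functor_Obj[OF F]
      by (simp add: \<eta>''_def whisker_left_def whisker_right_def cong: restrict_cong)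
  qed
  have counit: "nat_trans E E (comp_functor E (comp_functor C F' F) (comp_functor E G G'))
      (id_functor E) \<epsilon>''"
  proof -
    let ?s = "whisker_right E (whisker_left D F' \<epsilon>) G'"
    have "nat_trans E E (comp_functor E (comp_functor D F' (comp_functor D F G)) G')
        (comp_functor E (comp_functor D F' (id_functor D)) G') ?s"
      by (rule nat_trans_whisker_right[OF nat_trans_whisker_left[OF \<epsilon> F'] G'])
    then have "nat_trans E E (comp_functor E (comp_functor C F' F) (comp_functor E G G'))
        (comp_functor E F' G') ?s"
      by (simp add: comp_functor_id_right[OF F'] comp_functor_assoc[OF G'] comp_functor_assoc[OF GG'])
    from nat_trans_vcomp[OF this \<epsilon>'] show ?thesis
      using functor_Obj[OF G']
      by (simp add: \<epsilon>''_def whisker_left_def whisker_right_def cong: restrict_cong)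
  qed

  have e: "\<epsilon> x \<in> hom D (Fob F (Fob G x)) x" if "x \<in> Obj D" for x
    using nat_trans_hom[OF \<epsilon> that] that by simp
  have h: "\<eta> x \<in> hom C x (Fob G (Fob F x))" if "x \<in> Obj C" for x
    using nat_trans_hom[OF \<eta> that] that by simp
  have e': "\<epsilon>' x \<in> hom E (Fob F' (Fob G' x)) x" if "x \<in> Obj E" for x
    using nat_trans_hom[OF \<epsilon>' that] that by simp
  have h': "\<eta>' x \<in> hom D x (Fob G' (Fob F' x))" if "x \<in> Obj D" for x
    using nat_trans_hom[OF \<eta>' that] that by simp

  have triangle1: "\<epsilon>'' (Fob F' (Fob F a)) \<cdot>\<^bsub>E\<^esub> Far F' (Far F (\<eta>'' a)) = Id E (Fob F' (Fob F a))"
    if a: "a \<in> Obj C" for a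
  proof -
    define x y where "x = Fob F a" and "y = Fob F' x"
    have x: "x \<in> Obj D" and y: "y \<in> Obj E" and z: "Fob G' y \<in> Obj D"
      unfolding x_def y_def using a functor_Obj F F' G' by metis+
    have ha: "\<eta> a \<in> hom C a (Fob G x)" using h[OF a] by (simp add: x_def)
    have hx: "\<eta>' x \<in> hom D x (Fob G' y)" using h'[OF x] by (simp add: y_def)
    note Ghx = functor_hom[OF G hx]
    note ez = e[OF z] and Fha = functor_hom[OF F ha] and FGhx = functor_hom[OF F Ghx]
    have nat: "\<epsilon> (Fob G' y) \<cdot>\<^bsub>D\<^esub> Far F (Far G (\<eta>' x)) = \<eta>' x \<cdot>\<^bsub>D\<^esub> \<epsilon> x"
      using nat_trans_square[OF \<epsilon> hx] homD(1)[OF hx] by simp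
    have "\<epsilon> (Fob G' y) \<cdot>\<^bsub>D\<^esub> Far F (Far G (\<eta>' x) \<cdot>\<^bsub>C\<^esub> \<eta> a) =
        (\<epsilon> (Fob G' y) \<cdot>\<^bsub>D\<^esub> Far F (Far G (\<eta>' x))) \<cdot>\<^bsub>D\<^esub> Far F (\<eta> a)"
      using functor_Comp[OF F ha Ghx] D.Comp_assoc[OF Fha FGhx ez] by (simp add: x_def)
    also have "\<dots> = \<eta>' x \<cdot>\<^bsub>D\<^esub> (\<epsilon> x \<cdot>\<^bsub>D\<^esub> Far F (\<eta> a))"
      unfolding nat using D.Comp_assoc[OF _ e[OF x] hx] Fha by (simp add: x_def)
    also have "\<dots> = \<eta>' x"
      using tri1[OF a] D.Comp_Id[OF hx] by (simp add: x_def)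
    finally have inner: "\<epsilon> (Fob G' y) \<cdot>\<^bsub>D\<^esub> Far F (Far G (\<eta>' x) \<cdot>\<^bsub>C\<^esub> \<eta> a) = \<eta>' x" .
    have c: "Far F (Far G (\<eta>' x) \<cdot>\<^bsub>C\<^esub> \<eta> a) \<in> hom D x (Fob F (Fob G (Fob G' y)))"
      using functor_hom[OF F C.Comp_in_hom[OF ha Ghx]] by (simp add: x_def)
    have "(\<epsilon>' y \<cdot>\<^bsub>E\<^esub> Far F' (\<epsilon> (Fob G' y))) \<cdot>\<^bsub>E\<^esub> Far F' (Far F (Far G (\<eta>' x) \<cdot>\<^bsub>C\<^esub> \<eta> a)) =
        \<epsilon>' y \<cdot>\<^bsub>E\<^esub> Far F' (\<eta>' x)"
      using E.Comp_assoc[OF functor_hom[OF F' c] functor_hom[OF F' ez] e'[OF y]]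
        functor_Comp[OF F' c ez] inner by simp
    also have "\<dots> = Id E y"
      using tri1'[OF x] by (simp add: y_def)
    finally have "\<epsilon>'' y \<cdot>\<^bsub>E\<^esub> Far F' (Far F (\<eta>'' a)) = Id E y"
      by (simp only: \<eta>''_def \<epsilon>''_def restrict_apply' a y x_def[symmetric])
    then show ?thesis
      by (simp only: x_def y_def)
  qed
  have triangle2: "Far G (Far G' (\<epsilon>'' b)) \<cdot>\<^bsub>C\<^esub> \<eta>'' (Fob G (Fob G' b)) = Id C (Fob G (Fob G' b))"
    if b: "b \<in> Obj E" for b
  proof -
    define z w where "z = Fob G' b" and "w = Fob G z"
    have z: "z \<in> Obj D" and w: "w \<in> Obj C" and x: "Fob F w \<in> Obj D"
      unfolding z_def w_def using b functor_Obj F G G' by metis+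
    have eb: "\<epsilon>' b \<in> hom E (Fob F' z) b" using e'[OF b] by (simp add: z_def)
    have ez: "\<epsilon> z \<in> hom D (Fob F w) z" using e[OF z] by (simp add: w_def)
    note F'ez = functor_hom[OF F' ez]
    note hx = h'[OF x] and G'eb = functor_hom[OF G' eb] and G'F'ez = functor_hom[OF G' F'ez]
    have nat: "Far G' (Far F' (\<epsilon> z)) \<cdot>\<^bsub>D\<^esub> \<eta>' (Fob F w) = \<eta>' z \<cdot>\<^bsub>D\<^esub> \<epsilon> z"
      using nat_trans_square[OF \<eta>' ez] homD(1)[OF ez] by simp
    have "Far G' (\<epsilon>' b \<cdot>\<^bsub>E\<^esub> Far F' (\<epsilon> z)) \<cdot>\<^bsub>D\<^esub> \<eta>' (Fob F w) =
        Far G' (\<epsilon>' b) \<cdot>\<^bsub>D\<^esub> (Far G' (Far F' (\<epsilon> z)) \<cdot>\<^bsub>D\<^esub> \<eta>' (Fob F w))"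
      using functor_Comp[OF G' F'ez eb] D.Comp_assoc[OF hx G'F'ez G'eb] by simp
    also have "\<dots> = (Far G' (\<epsilon>' b) \<cdot>\<^bsub>D\<^esub> \<eta>' z) \<cdot>\<^bsub>D\<^esub> \<epsilon> z"
      unfolding nat using D.Comp_assoc[OF ez h'[OF z] G'eb] by simp
    also have "\<dots> = \<epsilon> z"
      using tri2'[OF b] D.Id_Comp[OF ez] by (simp add: z_def)
    finally have inner: "Far G' (\<epsilon>' b \<cdot>\<^bsub>E\<^esub> Far F' (\<epsilon> z)) \<cdot>\<^bsub>D\<^esub> \<eta>' (Fob F w) = \<epsilon> z" .
    have c: "Far G' (\<epsilon>' b \<cdot>\<^bsub>E\<^esub> Far F' (\<epsilon> z)) \<in> hom D (Fob G' (Fob F' (Fob F w))) z"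
      using functor_hom[OF G' E.Comp_in_hom[OF F'ez eb]] by (simp add: z_def)
    have "Far G (Far G' (\<epsilon>' b \<cdot>\<^bsub>E\<^esub> Far F' (\<epsilon> z))) \<cdot>\<^bsub>C\<^esub> (Far G (\<eta>' (Fob F w)) \<cdot>\<^bsub>C\<^esub> \<eta> w) =
        Far G (\<epsilon> z) \<cdot>\<^bsub>C\<^esub> \<eta> w"
      using C.Comp_assoc[OF h[OF w] functor_hom[OF G hx] functor_hom[OF G c]]
        functor_Comp[OF G hx c] inner by simp
    also have "\<dots> = Id C w"
      using tri2[OF z] by (simp add: w_def)
    finally have "Far G (Far G' (\<epsilon>'' b)) \<cdot>\<^bsub>C\<^esub> \<eta>'' w = Id C w"
      by (simp only: \<eta>''_def \<epsilon>''_def restrict_apply' b w z_def[symmetric])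
    then show ?thesis
      by (simp only: z_def w_def)
  qed

  show ?thesis
  proof (rule left_adjointI[OF FF' GG' unit counit])
    show "\<epsilon>'' (Fob (comp_functor C F' F) a) \<cdot>\<^bsub>E\<^esub> Far (comp_functor C F' F) (\<eta>'' a) =
        Id E (Fob (comp_functor C F' F) a)" if "a \<in> Obj C" for a
      using triangle1[OF that] homD(1)[OF nat_trans_hom[OF unit that]] that by simp
    show "Far (comp_functor E G G') (\<epsilon>'' b) \<cdot>\<^bsub>C\<^esub> \<eta>'' (Fob (comp_functor E G G') b) =
        Id C (Fob (comp_functor E G G') b)" if "b \<in> Obj E" for b
      using triangle2[OF that] homD(1)[OF nat_trans_hom[OF counit that]] that by simp
  qed
qed

section \<open>Categories of left Quillen functors\<close>

lemma left_quillen_functor: "left_quillen M N F \<Longrightarrow> is_functor (Und M) (Und N) F"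
  by (simp add: left_quillen_def left_adjoint_functor)

lemma left_quillen_comp:
  assumes F: "left_quillen M N F" and G: "left_quillen N K G" and M: "Cof M \<subseteq> Arr (Und M)"
  shows "left_quillen M K (comp_functor (Und M) G F)"
proof -
  have image: "Far (comp_functor (Und M) G F) ` S = Far G ` Far F ` S" if "S \<subseteq> Arr (Und M)" for S
    unfolding image_image using that by (intro image_cong) auto
  have "Far (comp_functor (Und M) G F) ` Cof M = Far G ` Far F ` Cof M"
    "Far (comp_functor (Und M) G F) ` (Cof M \<inter> Weq M) = Far G ` Far F ` (Cof M \<inter> Weq M)"
    using image[OF M] image[OF le_infI1[OF M]] by simp_all
  moreover have "left_adjoint (Und M) (Und K) (comp_functor (Und M) G F)"
    using F G by (auto simp: left_quillen_def intro: left_adjoint_comp)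
  moreover have "Far G ` Far F ` Cof M \<subseteq> Cof K"
    "Far G ` Far F ` (Cof M \<inter> Weq M) \<subseteq> Cof K \<inter> Weq K"
    using F G unfolding left_quillen_def by (meson image_mono order_trans)+
  ultimately show ?thesis
    by (simp only: left_quillen_def simp_thms)
qed

lemma LQ_Obj [simp]: "F \<in> Obj (LQ M N) \<longleftrightarrow> left_quillen M N F"
  by (auto simp: LQ_def full_subcategory_def functor_category_def left_quillen_functor)

lemma LQ_simps [simp]:
  "Dom (LQ M N) (F, G, \<tau>) = F"
  "Cod (LQ M N) (F, G, \<tau>) = G"
  "Id (LQ M N) F = (F, F, \<lambda>a\<in>Obj (Und M). Id (Und N) (Fob F a))"
  "(G', H, \<sigma>) \<cdot>\<^bsub>LQ M N\<^esub> (F, G, \<tau>) = (F, H, \<lambda>a\<in>Obj (Und M). \<sigma> a \<cdot>\<^bsub>Und N\<^esub> \<tau> a)"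
  "(F, G, \<tau>) \<in> Arr (LQ M N) \<longleftrightarrow>
    nat_trans (Und M) (Und N) F G \<tau> \<and> left_quillen M N F \<and> left_quillen M N G"
  by (auto simp: LQ_def full_subcategory_def functor_category_def)

lemma LQ_hom: "f \<in> hom (LQ M N) F G \<longleftrightarrow>
    (\<exists>\<tau>. f = (F, G, \<tau>) \<and> nat_trans (Und M) (Und N) F G \<tau> \<and>
      left_quillen M N F \<and> left_quillen M N G)"
  by (cases f) (auto simp: hom_def)

lemma LQ_homE:
  assumes "f \<in> hom (LQ M N) F G"
  obtains \<tau> where "f = (F, G, \<tau>)" "nat_trans (Und M) (Und N) F G \<tau>"
    "left_quillen M N F" "left_quillen M N G"
  using assms by (auto simp: LQ_hom)

lemma category_LQ: "category (LQ M N)"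
proof
  fix f assume "f \<in> Arr (LQ M N)"
  then show "Dom (LQ M N) f \<in> Obj (LQ M N)" "Cod (LQ M N) f \<in> Obj (LQ M N)"
    by (cases f; simp)+
next
  fix F assume "F \<in> Obj (LQ M N)"
  then show "Id (LQ M N) F \<in> hom (LQ M N) F F"
    by (simp add: LQ_hom nat_trans_id[OF left_quillen_functor])
next
  fix f g F G H assume "f \<in> hom (LQ M N) F G" "g \<in> hom (LQ M N) G H"
  then show "g \<cdot>\<^bsub>LQ M N\<^esub> f \<in> hom (LQ M N) F H"
    by (auto simp: LQ_hom nat_trans_vcomp)
next
  fix f F G assume "f \<in> hom (LQ M N) F G"
  then obtain \<tau> where f: "f = (F, G, \<tau>)" and \<tau>: "nat_trans (Und M) (Und N) F G \<tau>"
    by (rule LQ_homE)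
  interpret N: category "Und N"
    by (rule functor_category_target[OF nat_trans_functors(1)[OF \<tau>]])
  have ext: "restrict \<tau> (Obj (Und M)) = \<tau>"
    using \<tau> by (simp add: nat_trans_def extensional_restrict)
  show "f \<cdot>\<^bsub>LQ M N\<^esub> Id (LQ M N) F = f" "Id (LQ M N) G \<cdot>\<^bsub>LQ M N\<^esub> f = f"
    using N.Comp_Id[OF nat_trans_hom[OF \<tau>]] N.Id_Comp[OF nat_trans_hom[OF \<tau>]] ext
    by (simp_all add: f cong: restrict_cong)
next
  fix f g h F G H K
  assume "f \<in> hom (LQ M N) F G" "g \<in> hom (LQ M N) G H" "h \<in> hom (LQ M N) H K"
  then obtain \<tau> \<sigma> \<rho> where fgh: "f = (F, G, \<tau>)" "g = (G, H, \<sigma>)" "h = (H, K, \<rho>)"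
    and nt: "nat_trans (Und M) (Und N) F G \<tau>" "nat_trans (Und M) (Und N) G H \<sigma>"
      "nat_trans (Und M) (Und N) H K \<rho>"
    by (auto elim!: LQ_homE)
  interpret N: category "Und N"
    by (rule functor_category_target[OF nat_trans_functors(1)[OF nt(1)]])
  show "(h \<cdot>\<^bsub>LQ M N\<^esub> g) \<cdot>\<^bsub>LQ M N\<^esub> f = h \<cdot>\<^bsub>LQ M N\<^esub> (g \<cdot>\<^bsub>LQ M N\<^esub> f)"
    using N.Comp_assoc[OF nat_trans_hom[OF nt(1)] nat_trans_hom[OF nt(2)] nat_trans_hom[OF nt(3)]]
    by (simp add: fgh cong: restrict_cong)
qed

lemma LQ_iso_iff:
  assumes "left_quillen M N F" "left_quillen M N G" and \<tau>: "nat_trans (Und M) (Und N) F G \<tau>"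
  shows "iso (LQ M N) (F, G, \<tau>) \<longleftrightarrow> nat_iso (Und M) (Und N) F G \<tau>"
proof
  have f: "(F, G, \<tau>) \<in> hom (LQ M N) F G"
    using assms by (simp add: LQ_hom)
  show "nat_iso (Und M) (Und N) F G \<tau>" if iso: "iso (LQ M N) (F, G, \<tau>)"
  proof -
    obtain g where g: "g \<in> hom (LQ M N) G F" "g \<cdot>\<^bsub>LQ M N\<^esub> (F, G, \<tau>) = Id (LQ M N) F"
      "(F, G, \<tau>) \<cdot>\<^bsub>LQ M N\<^esub> g = Id (LQ M N) G"
      using isoE[OF iso f] .
    obtain \<sigma> where s: "g = (G, F, \<sigma>)" and \<sigma>: "nat_trans (Und M) (Und N) G F \<sigma>"
      using g(1) by (rule LQ_homE)
    have "iso (Und N) (\<tau> a)" if a: "a \<in> Obj (Und M)" for a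
    proof (rule isoI[OF nat_trans_hom[OF \<tau> a] nat_trans_hom[OF \<sigma> a]])
      show "\<sigma> a \<cdot>\<^bsub>Und N\<^esub> \<tau> a = Id (Und N) (Fob F a)"
        using g(2) a by (auto simp: s dest: fun_cong[of _ _ a])
      show "\<tau> a \<cdot>\<^bsub>Und N\<^esub> \<sigma> a = Id (Und N) (Fob G a)"
        using g(3) a by (auto simp: s dest: fun_cong[of _ _ a])
    qed
    then show ?thesis
      using \<tau> by (simp add: nat_iso_def)
  qed
  show "iso (LQ M N) (F, G, \<tau>)" if iso: "nat_iso (Und M) (Und N) F G \<tau>"
  proof -
    obtain \<sigma> where \<sigma>: "nat_trans (Und M) (Und N) G F \<sigma>"
      "\<And>a. a \<in> Obj (Und M) \<Longrightarrow> \<sigma> a \<cdot>\<^bsub>Und N\<^esub> \<tau> a = Id (Und N) (Fob F a)"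
      "\<And>a. a \<in> Obj (Und M) \<Longrightarrow> \<tau> a \<cdot>\<^bsub>Und N\<^esub> \<sigma> a = Id (Und N) (Fob G a)"
      using nat_iso_inverse[OF iso] by metis
    show ?thesis
      by (rule isoI[OF f, of "(G, F, \<sigma>)"]) (use assms \<sigma> in \<open>auto simp: LQ_hom cong: restrict_cong\<close>)
  qed
qed

lemma LQ_isoE:
  assumes "f \<in> hom (LQ M N) F G" "iso (LQ M N) f"
  obtains \<tau> where "f = (F, G, \<tau>)" "nat_iso (Und M) (Und N) F G \<tau>"
proof -
  from assms(1) obtain \<tau> where \<tau>: "f = (F, G, \<tau>)" "nat_trans (Und M) (Und N) F G \<tau>"
    "left_quillen M N F" "left_quillen M N G"
    by (rule LQ_homE)
  have "nat_iso (Und M) (Und N) F G \<tau>"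
    using LQ_iso_iff[OF \<tau>(3,4,2)] assms(2) \<tau>(1) by simp
  with \<tau>(1) show thesis
    by (rule that)
qed

lemma is_functor_LQ_postcomp:
  assumes L: "left_quillen M N L" and Z: "Cof Z \<subseteq> Arr (Und Z)"
  shows "is_functor (LQ Z M) (LQ Z N) (LQ_postcomp Z M L)"
proof (rule is_functorI)
  note FL = left_quillen_functor[OF L]
  show "category (LQ Z M)" "category (LQ Z N)"
    by (rule category_LQ)+
  show "Fob (LQ_postcomp Z M L) \<in> extensional (Obj (LQ Z M))"
    "Far (LQ_postcomp Z M L) \<in> extensional (Arr (LQ Z M))"
    by (simp_all add: LQ_postcomp_def)
  show "Fob (LQ_postcomp Z M L) F \<in> Obj (LQ Z N)" if "F \<in> Obj (LQ Z M)" for F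
    using that left_quillen_comp[OF _ L Z] by (simp add: LQ_postcomp_def)
  show "Far (LQ_postcomp Z M L) f \<in>
      hom (LQ Z N) (Fob (LQ_postcomp Z M L) F) (Fob (LQ_postcomp Z M L) G)"
    if "f \<in> hom (LQ Z M) F G" for f F G
    using that by (elim LQ_homE)
      (simp add: LQ_postcomp_def LQ_hom left_quillen_comp[OF _ L Z] nat_trans_whisker_left[OF _ FL])
  show "Far (LQ_postcomp Z M L) (Id (LQ Z M) F) = Id (LQ Z N) (Fob (LQ_postcomp Z M L) F)"
    if "F \<in> Obj (LQ Z M)" for F
  proof -
    have F: "is_functor (Und Z) (Und M) F" and lq: "left_quillen Z M F"
      using that left_quillen_functor by auto
    show ?thesis
      using nat_trans_id[OF F] lq functor_Id[OF FL functor_Obj[OF F]]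
      by (simp add: LQ_postcomp_def whisker_left_def cong: restrict_cong)
  qed
  show "Far (LQ_postcomp Z M L) (g \<cdot>\<^bsub>LQ Z M\<^esub> f) =
      Far (LQ_postcomp Z M L) g \<cdot>\<^bsub>LQ Z N\<^esub> Far (LQ_postcomp Z M L) f"
    if f: "f \<in> hom (LQ Z M) F G" and g: "g \<in> hom (LQ Z M) G H" for f g F G H
  proof -
    obtain \<tau> \<sigma> where fg: "f = (F, G, \<tau>)" "g = (G, H, \<sigma>)"
      and nt: "nat_trans (Und Z) (Und M) F G \<tau>" "nat_trans (Und Z) (Und M) G H \<sigma>"
      and lq: "left_quillen Z M F" "left_quillen Z M G" "left_quillen Z M H"
      using f g by (auto elim!: LQ_homE)
    show ?thesis
      using functor_Comp[OF FL nat_trans_hom[OF nt(1)] nat_trans_hom[OF nt(2)]]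
        nat_trans_vcomp[OF nt] nt lq
      by (simp add: fg LQ_postcomp_def whisker_left_def cong: restrict_cong)
  qed
qed

text \<open>Transformations are extensional, so whiskering with an identity functor returns them on the
  nose. Since \<open>id_functor (Und M)\<close> is a functor between different model structures on one category,
  postcomposition with it acts as the inclusion of one category of left Quillen functors into
  another.\<close>

lemma LQ_postcomp_id:
  shows "left_quillen Z M F \<Longrightarrow> Fob (LQ_postcomp Z M (id_functor (Und M))) F = F"
    and "f \<in> Arr (LQ Z M) \<Longrightarrow> Far (LQ_postcomp Z M (id_functor (Und M))) f = f"
proof -
  show "Fob (LQ_postcomp Z M (id_functor (Und M))) F = F" if "left_quillen Z M F"
    using that comp_functor_id_left[OF left_quillen_functor] by (simp add: LQ_postcomp_def)
  assume f: "f \<in> Arr (LQ Z M)"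
  obtain F G \<tau> where [simp]: "f = (F, G, \<tau>)" by (cases f)
  from f have \<tau>: "nat_trans (Und Z) (Und M) F G \<tau>" by simp
  have "whisker_left (Und Z) (id_functor (Und M)) \<tau> = \<tau>"
    using homD(1)[OF nat_trans_hom[OF \<tau>]] \<tau>
    by (auto simp: whisker_left_def nat_trans_def intro!: extensionalityI[of _ "Obj (Und Z)"])
  then show "Far (LQ_postcomp Z M (id_functor (Und M))) f = f"
    using f \<tau> comp_functor_id_left[OF nat_trans_functors(1)[OF \<tau>]]
      comp_functor_id_left[OF nat_trans_functors(2)[OF \<tau>]]
    by (simp add: LQ_postcomp_def)
qed

section \<open>Pseudopullbacks\<close>

lemma pseudopullback_Obj [simp]:
  "(a, b, \<phi>) \<in> Obj (pseudopullback A B C F G) \<longleftrightarrow>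
    a \<in> Obj A \<and> b \<in> Obj B \<and> \<phi> \<in> hom C (Fob F a) (Fob G b) \<and> iso C \<phi>"
  by (simp add: pseudopullback_def)

lemma pseudopullback_hom:
  "h \<in> hom (pseudopullback A B C F G) (a, b, \<phi>) (a', b', \<phi>') \<longleftrightarrow>
    (\<exists>f g. h = ((a, b, \<phi>), (a', b', \<phi>'), (f, g)) \<and>
      (a, b, \<phi>) \<in> Obj (pseudopullback A B C F G) \<and>
      (a', b', \<phi>') \<in> Obj (pseudopullback A B C F G) \<and>
      f \<in> hom A a a' \<and> g \<in> hom B b b' \<and> Far G g \<cdot>\<^bsub>C\<^esub> \<phi> = \<phi>' \<cdot>\<^bsub>C\<^esub> Far F f)"
  by (cases h) (auto simp: pseudopullback_def hom_def)

text \<open>Componentwise inverses form an arrow of the pseudopullback: inverting the two sides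
  \<open>F f\<close> and \<open>G g\<close> of the given square yields the compatibility square of the inverses.\<close>

lemma pseudopullback_isomorphicI:
  assumes FG: "is_functor A C F" "is_functor B C G"
    and x: "(a, b, \<phi>) \<in> Obj (pseudopullback A B C F G)"
    and x': "(a', b', \<phi>') \<in> Obj (pseudopullback A B C F G)"
    and f: "f \<in> hom A a a'" "iso A f" and g: "g \<in> hom B b b'" "iso B g"
    and square: "Far G g \<cdot>\<^bsub>C\<^esub> \<phi> = \<phi>' \<cdot>\<^bsub>C\<^esub> Far F f"
  shows "isomorphic_objects (pseudopullback A B C F G) (a, b, \<phi>) (a', b', \<phi>')"
proof -
  interpret A: category A by (rule functor_category_source[OF FG(1)])
  interpret B: category B by (rule functor_category_source[OF FG(2)])
  interpret C: category C by (rule functor_category_target[OF FG(1)])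
  obtain f' where f': "f' \<in> hom A a' a" "f' \<cdot>\<^bsub>A\<^esub> f = Id A a" "f \<cdot>\<^bsub>A\<^esub> f' = Id A a'"
    using isoE[OF f(2,1)] .
  obtain g' where g': "g' \<in> hom B b' b" "g' \<cdot>\<^bsub>B\<^esub> g = Id B b" "g \<cdot>\<^bsub>B\<^esub> g' = Id B b'"
    using isoE[OF g(2,1)] .
  have Ff: "Far F f \<cdot>\<^bsub>C\<^esub> Far F f' = Id C (Fob F a')"
    using functor_Comp[OF FG(1) f'(1) f(1)] functor_Id[OF FG(1)] f'(3) x' by simp
  have Gg: "Far G g' \<cdot>\<^bsub>C\<^esub> Far G g = Id C (Fob G b)"
    using functor_Comp[OF FG(2) g(1) g'(1)] functor_Id[OF FG(2)] g'(2) x by simp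
  have "Far G g' \<cdot>\<^bsub>C\<^esub> \<phi>' = \<phi> \<cdot>\<^bsub>C\<^esub> Far F f'"
    using C.square_inverse[OF functor_hom[OF FG(1) f(1)] functor_hom[OF FG(1) f'(1)] Ff
        functor_hom[OF FG(2) g(1)] functor_hom[OF FG(2) g'(1)] Gg _ _ square] x x'
    by simp
  then have h: "((a, b, \<phi>), (a', b', \<phi>'), (f, g)) \<in>
      hom (pseudopullback A B C F G) (a, b, \<phi>) (a', b', \<phi>')"
    and h': "((a', b', \<phi>'), (a, b, \<phi>), (f', g')) \<in>
      hom (pseudopullback A B C F G) (a', b', \<phi>') (a, b, \<phi>)"
    using x x' f f' g g' square by (simp_all add: pseudopullback_hom)
  have "iso (pseudopullback A B C F G) ((a, b, \<phi>), (a', b', \<phi>'), (f, g))"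
    by (rule isoI[OF h h']) (use f' g' in \<open>simp_all add: pseudopullback_def\<close>)
  with h show ?thesis
    by (auto simp: isomorphic_objects_def)
qed

lemma pseudopullback_isomorphicE:
  assumes "isomorphic_objects (pseudopullback A B C F G) (a, b, \<phi>) (a', b', \<phi>')"
  obtains f g where "f \<in> hom A a a'" "iso A f" "g \<in> hom B b b'" "iso B g"
    "Far G g \<cdot>\<^bsub>C\<^esub> \<phi> = \<phi>' \<cdot>\<^bsub>C\<^esub> Far F f"
proof -
  let ?P = "pseudopullback A B C F G"
  obtain h where h: "h \<in> hom ?P (a, b, \<phi>) (a', b', \<phi>')" "iso ?P h"
    using assms by (auto simp: isomorphic_objects_def)
  obtain k where k: "k \<in> hom ?P (a', b', \<phi>') (a, b, \<phi>)" "k \<cdot>\<^bsub>?P\<^esub> h = Id ?P (a, b, \<phi>)"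
    "h \<cdot>\<^bsub>?P\<^esub> k = Id ?P (a', b', \<phi>')"
    using isoE[OF h(2,1)] .
  obtain f g where fg: "h = ((a, b, \<phi>), (a', b', \<phi>'), (f, g))" "f \<in> hom A a a'" "g \<in> hom B b b'"
    "Far G g \<cdot>\<^bsub>C\<^esub> \<phi> = \<phi>' \<cdot>\<^bsub>C\<^esub> Far F f"
    using h(1) by (auto simp only: pseudopullback_hom)
  obtain f' g' where fg': "k = ((a', b', \<phi>'), (a, b, \<phi>), (f', g'))" "f' \<in> hom A a' a"
    "g' \<in> hom B b' b"
    using k(1) by (auto simp only: pseudopullback_hom)
  have "iso A f" "iso B g"
    using k(2,3) fg fg' isoI[of f A a a' f'] isoI[of g B b b' g']
    by (simp_all add: pseudopullback_def)
  with fg that show thesis by blast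
qed

section \<open>The minimal model structure\<close>

definition minimal_model :: "('o, 'm) cat \<Rightarrow> ('o, 'm) model_cat" where
  "minimal_model C = \<lparr>Und = C, Weq = Arr C, Cof = {f \<in> Arr C. iso C f}, Fib = Arr C\<rparr>"

lemma Und_minimal_model [simp]: "Und (minimal_model C) = C"
  by (simp add: minimal_model_def)

lemma (in category) iso_has_lifting:
  assumes i: "i \<in> hom C a b" "iso C i" and p: "p \<in> hom C c d"
  shows "has_lifting C i p"
proof -
  obtain j where j: "j \<in> hom C b a" "j \<cdot> i = Id C a" "i \<cdot> j = Id C b"
    using isoE[OF i(2,1)] .
  show ?thesis
    unfolding has_lifting_def homD(2)[OF i(1)] homD(3)[OF i(1)] homD(2)[OF p] homD(3)[OF p]
  proof (intro ballI impI bexI conjI)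
    fix u v assume u: "u \<in> hom C a c" and v: "v \<in> hom C b d" and square: "p \<cdot> u = v \<cdot> i"
    show "u \<cdot> j \<in> hom C b c"
      using u j Comp_in_hom by blast
    show "(u \<cdot> j) \<cdot> i = u"
      using Comp_assoc[OF i(1) j(1) u] j(2) Comp_Id[OF u] by simp
    have "p \<cdot> (u \<cdot> j) = (v \<cdot> i) \<cdot> j"
      using Comp_assoc[OF j(1) u p] square by simp
    then show "p \<cdot> (u \<cdot> j) = v"
      using Comp_assoc[OF j(1) i(1) v] j(3) Comp_Id[OF v] by simp
  qed
qed

text \<open>A lift in the square from \<open>i\<close> to \<open>i\<close> whose other two sides are identities is an
  inverse of \<open>i\<close>.\<close>

lemma (in category) has_lifting_self:
  assumes i: "i \<in> Arr C" and lift: "has_lifting C i i"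
  shows "iso C i"
proof -
  let ?a = "Dom C i" and ?b = "Cod C i"
  have h: "i \<in> hom C ?a ?b"
    using i by (simp add: hom_def)
  have "Id C ?a \<in> hom C ?a ?a" "Id C ?b \<in> hom C ?b ?b" "i \<cdot> Id C ?a = Id C ?b \<cdot> i"
    using Id_in_hom hom_Obj[OF h] Comp_Id[OF h] Id_Comp[OF h] by auto
  then obtain j where "j \<in> hom C ?b ?a" "j \<cdot> i = Id C ?a" "i \<cdot> j = Id C ?b"
    using lift unfolding has_lifting_def by blast
  with h show ?thesis
    by (auto intro: isoI)
qed

text \<open>With all maps as right class, a member of the left class lifts against itself and so is
  invertible; every map factors through an identity. For the minimal structure both factorization
  systems of a model category are this one, because every map is a weak equivalence.\<close>

lemma weak_factorization_system_iso_Arr: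
  assumes "category C"
  shows "weak_factorization_system C {f \<in> Arr C. iso C f} (Arr C)"
proof -
  interpret category C by (rule assms)
  have lift: "has_lifting C i p" if "i \<in> Arr C" "iso C i" "p \<in> Arr C" for i p
    using iso_has_lifting[of i "Dom C i" "Cod C i" p "Dom C p" "Cod C p"] that
    by (simp add: hom_def)
  have "\<exists>i \<in> {f \<in> Arr C. iso C f}. \<exists>p \<in> Arr C. Cod C i = Dom C p \<and> f = p \<cdot>\<^bsub>C\<^esub> i"
    if f: "f \<in> Arr C" for f
  proof (intro bexI conjI)
    have a: "Dom C f \<in> Obj C" using f by (rule Dom_in_Obj)
    show "f = f \<cdot>\<^bsub>C\<^esub> Id C (Dom C f)"
      using Comp_Id[of f "Dom C f" "Cod C f"] f by (simp add: hom_def)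
    show "Id C (Dom C f) \<in> {f \<in> Arr C. iso C f}" "Cod C (Id C (Dom C f)) = Dom C f"
      using Id_in_hom[OF a] iso_Id[OF a] by (auto simp: hom_def)
  qed (rule f)
  then show ?thesis
    unfolding weak_factorization_system_def using lift has_lifting_self by blast
qed

lemma model_category_minimal:
  assumes M: "model_category \<kappa> \<mu> M"
  shows "model_category \<kappa> \<mu> (minimal_model (Und M))"
proof -
  have "category (Und M)"
    using M by (simp add: model_category_def)
  then have "two_out_of_three (Und M) (Arr (Und M))"
    using category.Comp_in_hom[of "Und M"] unfolding two_out_of_three_def hom_def by blast
  moreover have "{f \<in> Arr (Und M). iso (Und M) f} \<inter> Arr (Und M) = {f \<in> Arr (Und M). iso (Und M) f}"
    by blast
  ultimately show ?thesis
    using M weak_factorization_system_iso_Arr[of "Und M"]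
    by (auto simp: model_category_def minimal_model_def)
qed

text \<open>Functors preserve isomorphisms, and isomorphisms lift against every map, so they are acyclic
  cofibrations in every model category. On the minimal structure, being left Quillen thus imposes nothing
  beyond being a left adjoint.\<close>

lemma left_quillen_minimal:
  assumes N: "model_category \<kappa> \<mu> N"
  shows "left_quillen (minimal_model C) N F \<longleftrightarrow> left_adjoint C (Und N) F"
proof
  assume F: "left_adjoint C (Und N) F"
  interpret category "Und N"
    using N by (simp add: model_category_def)
  have iso_Cof: "i \<in> Cof N \<inter> Weq N" if "i \<in> Arr (Und N)" "iso (Und N) i" for i
  proof -
    have "has_lifting (Und N) i p" if "p \<in> Arr (Und N)" for p
      using iso_has_lifting[of i "Dom (Und N) i" "Cod (Und N) i" p "Dom (Und N) p" "Cod (Und N) p"]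
        \<open>iso (Und N) i\<close> \<open>i \<in> Arr (Und N)\<close> that by (simp add: hom_def)
    then show ?thesis
      using N that unfolding model_category_def weak_factorization_system_def by blast
  qed
  have "Far F f \<in> Cof N \<inter> Weq N" if "f \<in> Arr C" "iso C f" for f
  proof (rule iso_Cof)
    have f: "f \<in> hom C (Dom C f) (Cod C f)"
      using that by (simp add: hom_def)
    show "Far F f \<in> Arr (Und N)" "iso (Und N) (Far F f)"
      using functor_hom[OF left_adjoint_functor[OF F] f] homD(1)
        functor_iso[OF left_adjoint_functor[OF F] f that(2)] by auto
  qed
  with F show "left_quillen (minimal_model C) N F"
    by (auto simp: left_quillen_def minimal_model_def)
qed (simp add: left_quillen_def minimal_model_def)

section \<open>Pullbacks along identity functors\<close>

theorem proposition1p2p2: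
  fixes M :: "('o, 'm) cat"
    and M0 M1 M2 M3 :: "('o, 'm) model_cat"
    and P1 P2 :: "('o, 'm, 'o, 'm) ftor"
    and \<phi> :: "'o \<Rightarrow> 'm"
    and \<kappa> :: "'u rel"
    and \<mu> :: "'v rel"
  assumes "Card_order \<kappa>" and "\<not> finite (Field \<kappa>)"
    and "Card_order \<mu>" and "\<not> finite (Field \<mu>)"
    and "model_category \<kappa> \<mu> M1" and "Und M1 = M"
    and "model_category \<kappa> \<mu> M2" and "Und M2 = M"
    and "model_category \<kappa> \<mu> M3" and "Und M3 = M"
    and "left_quillen M1 M3 (id_functor M)"
    and "left_quillen M2 M3 (id_functor M)"
    and "is_pullback \<kappa> \<mu> M1 M2 M3 (id_functor M) (id_functor M) M0 P1 P2 \<phi>"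
  shows "\<exists>E. is_equivalence M (Und M0) E \<and>
    isomorphic_functors M M (comp_functor M P1 E) (id_functor M) \<and>
    isomorphic_functors M M (comp_functor M P2 E) (id_functor M)"
proof -
  note model = assms(5,7,9) and Und [simp] = assms(6,8,10) and Quillen = assms(11,12)
  let ?I = "id_functor M"
  define C where "C = Und M0"
  have M0: "model_category \<kappa> \<mu> M0" and P: "left_quillen M0 M1 P1" "left_quillen M0 M2 P2"
    and \<phi>: "nat_iso C M (comp_functor C ?I P1) (comp_functor C ?I P2) \<phi>"
    and equiv: "\<And>Z :: ('o, 'm) model_cat. model_category \<kappa> \<mu> Z \<Longrightarrow>
      is_equivalence (LQ Z M0) (LQ_pseudopullback Z M1 M2 M3 ?I ?I)
        (induced_functor Z M0 M1 M2 ?I ?I P1 P2 \<phi>)"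
    using assms(13) by (auto simp: is_pullback_def C_def)
  have cat_M: "category M" and cat_C: "category C"
    using model(1) M0 by (auto simp: model_category_def C_def)
  have adj: "left_adjoint C M P1" "left_adjoint C M P2"
    using P by (simp_all add: left_quillen_def C_def)
  note FP = adj[THEN left_adjoint_functor]
  note I = is_functor_id[OF cat_M]
  note IP = FP[THEN comp_functor_id_left]
  have \<phi>: "nat_iso C M P1 P2 \<phi>"
    using \<phi> by (simp add: IP)
  then have nt_\<phi>: "nat_trans C M P1 P2 \<phi>"
    by (simp add: nat_iso_def)
  interpret M: category M by (rule cat_M)

  have K_ob: "Fob (induced_functor Z M0 M1 M2 ?I ?I P1 P2 \<phi>) F =
      (comp_functor (Und Z) P1 F, comp_functor (Und Z) P2 F,
        (comp_functor (Und Z) P1 F, comp_functor (Und Z) P2 F, whisker_right (Und Z) \<phi> F))"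
    if "left_quillen Z M0 F" for Z :: "('o, 'm) model_cat" and F
    using that IP by (simp add: induced_functor_def induced_object_def C_def)
  note min_model = model_category_minimal[OF model(1), simplified]
    model_category_minimal[OF M0, folded C_def]
  note min_iff = model(1,2,3)[THEN left_quillen_minimal] left_quillen_minimal[OF M0]

  \<comment> \<open>Test object \<open>M\<close>: essential surjectivity at the triple of identities yields \<open>E\<close>.\<close>
  let ?Z = "minimal_model M"
  let ?i = "\<lambda>a\<in>Obj M. Id M a"
  have lqI: "left_quillen ?Z M1 ?I" "left_quillen ?Z M2 ?I" "left_quillen ?Z M3 ?I"
    using left_adjoint_id[OF cat_M] by (simp_all add: min_iff)
  have nt_i: "nat_trans M M ?I ?I ?i" and iso_i: "nat_iso M M ?I ?I ?i"
    using nat_trans_id[OF I] M.iso_Id by (simp_all add: nat_iso_def cong: restrict_cong)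
  have "(?I, ?I, (?I, ?I, ?i)) \<in> Obj (LQ_pseudopullback ?Z M1 M2 M3 ?I ?I)"
    using lqI nt_i iso_i LQ_postcomp_id(1)[of ?Z M1 ?I] LQ_postcomp_id(1)[of ?Z M2 ?I]
    by (simp add: LQ_pseudopullback_def LQ_hom LQ_iso_iff)
  then obtain E where E: "left_quillen ?Z M0 E"
    and E_iso: "isomorphic_objects (LQ_pseudopullback ?Z M1 M2 M3 ?I ?I)
      (Fob (induced_functor ?Z M0 M1 M2 ?I ?I P1 P2 \<phi>) E) (?I, ?I, (?I, ?I, ?i))"
    using equivalence_essentially_surjective[OF equiv[OF min_model(1)]] by (metis LQ_Obj)
  have adj_E: "left_adjoint M C E"
    using E by (simp add: min_iff C_def)
  note FE = left_adjoint_functor[OF adj_E]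
  let ?P1E = "comp_functor M P1 E" and ?P2E = "comp_functor M P2 E"
  obtain f g where f: "f \<in> hom (LQ ?Z M1) ?P1E ?I" "iso (LQ ?Z M1) f"
    and g: "g \<in> hom (LQ ?Z M2) ?P2E ?I" "iso (LQ ?Z M2) g"
    and square: "Far (LQ_postcomp ?Z M2 ?I) g \<cdot>\<^bsub>LQ ?Z M3\<^esub> (?P1E, ?P2E, whisker_right M \<phi> E) =
      (?I, ?I, ?i) \<cdot>\<^bsub>LQ ?Z M3\<^esub> Far (LQ_postcomp ?Z M1 ?I) f"
    using E_iso unfolding K_ob[OF E] LQ_pseudopullback_def Und_minimal_model
    by (rule pseudopullback_isomorphicE)
  obtain \<alpha> where fa: "f = (?P1E, ?I, \<alpha>)" and \<alpha>: "nat_iso M M ?P1E ?I \<alpha>"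
    using LQ_isoE[OF f] by auto
  obtain \<beta> where gb: "g = (?P2E, ?I, \<beta>)" and \<beta>: "nat_iso M M ?P2E ?I \<beta>"
    using LQ_isoE[OF g] by auto
  have nt: "nat_trans M M ?P1E ?I \<alpha>" "nat_trans M M ?P2E ?I \<beta>"
    using \<alpha> \<beta> by (simp_all add: nat_iso_def)
  have \<alpha>_hom: "\<alpha> a \<in> hom M (Fob P1 (Fob E a)) a" if "a \<in> Obj M" for a
    using nat_trans_hom[OF nt(1) that] that by simp
  have \<beta>_hom: "\<beta> a \<in> hom M (Fob P2 (Fob E a)) a" if "a \<in> Obj M" for a
    using nat_trans_hom[OF nt(2) that] that by simp
  \<comment> \<open>Both whiskerings in \<open>square\<close> are with identity functors, so its components compare \<open>\<beta> \<cdot> \<phi>E\<close>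
    with \<open>\<alpha>\<close>.\<close>
  have "Far (LQ_postcomp ?Z M2 ?I) g = g" "Far (LQ_postcomp ?Z M1 ?I) f = f"
    using LQ_postcomp_id(2)[of g ?Z M2] LQ_postcomp_id(2)[of f ?Z M1] homD(1)[OF f(1)]
      homD(1)[OF g(1)] by simp_all
  with square have "(\<lambda>a\<in>Obj M. \<beta> a \<cdot>\<^bsub>M\<^esub> whisker_right M \<phi> E a) = (\<lambda>a\<in>Obj M. ?i a \<cdot>\<^bsub>M\<^esub> \<alpha> a)"
    by (simp add: fa gb)
  then have compatible: "\<beta> a \<cdot>\<^bsub>M\<^esub> \<phi> (Fob E a) = \<alpha> a" if "a \<in> Obj M" for a
    using that M.Id_Comp[OF \<alpha>_hom] by (auto simp: whisker_right_def dest: fun_cong[of _ _ a])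

  \<comment> \<open>Test object \<open>Und M0\<close>: \<open>E P1\<close> and the identity have isomorphic images.\<close>
  let ?Y = "minimal_model C"
  let ?EP = "comp_functor C E P1"
  let ?J = "id_functor C"
  have lqY: "left_quillen ?Y M0 ?EP" "left_quillen ?Y M0 ?J"
    using left_adjoint_comp[OF adj(1) adj_E] left_adjoint_id[OF cat_C]
    by (simp_all add: min_iff C_def)
  note JP = FP[THEN comp_functor_id_right]
  let ?\<alpha> = "whisker_right C \<alpha> P1"
  let ?\<beta> = "\<lambda>x\<in>Obj C. \<phi> x \<cdot>\<^bsub>M\<^esub> whisker_right C \<beta> P1 x"
  have isoA: "nat_iso C M (comp_functor C P1 ?EP) P1 ?\<alpha>"
    using nat_iso_whisker_right[OF \<alpha> FP(1)] by (simp add: IP comp_functor_assoc[OF FP(1)])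
  have isoB: "nat_iso C M (comp_functor C P2 ?EP) P2 ?\<beta>"
    using nat_iso_whisker_right[OF \<beta> FP(1)]
    by (intro nat_iso_vcomp[OF _ \<phi>]) (simp add: IP comp_functor_assoc[OF FP(1)])
  let ?K = "induced_functor ?Y M0 M1 M2 ?I ?I P1 P2 \<phi>"
  note equivY = equiv[OF min_model(2)]
  have "isomorphic_objects (LQ_pseudopullback ?Y M1 M2 M3 ?I ?I) (Fob ?K ?EP) (Fob ?K ?J)"
  proof -
    have ob: "Fob ?K ?EP = (comp_functor C P1 ?EP, comp_functor C P2 ?EP,
        (comp_functor C P1 ?EP, comp_functor C P2 ?EP, whisker_right C \<phi> ?EP))"
      using K_ob[OF lqY(1)] by simp
    have "whisker_right C \<phi> ?J = \<phi>"
      using nt_\<phi> by (auto simp: whisker_right_def nat_trans_def intro!: extensionalityI[of _ "Obj C"])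
    then have ob': "Fob ?K ?J = (P1, P2, (P1, P2, \<phi>))"
      using K_ob[OF lqY(2)] JP by simp
    have K: "is_functor (LQ ?Y M0) (LQ_pseudopullback ?Y M1 M2 M3 ?I ?I) ?K"
      using equivY by (simp add: is_equivalence_def)
    have obj: "Fob ?K ?EP \<in> Obj (LQ_pseudopullback ?Y M1 M2 M3 ?I ?I)"
      "Fob ?K ?J \<in> Obj (LQ_pseudopullback ?Y M1 M2 M3 ?I ?I)"
      using functor_Obj[OF K] lqY by simp_all
    have lqP: "left_quillen ?Y M1 (comp_functor C P1 ?EP)" "left_quillen ?Y M2 (comp_functor C P2 ?EP)"
      "left_quillen ?Y M1 P1" "left_quillen ?Y M2 P2"
      using left_adjoint_comp[OF left_adjoint_comp[OF adj(1) adj_E]] adj by (simp_all add: min_iff)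
    let ?f = "(comp_functor C P1 ?EP, P1, ?\<alpha>)" and ?g = "(comp_functor C P2 ?EP, P2, ?\<beta>)"
    have f: "?f \<in> hom (LQ ?Y M1) (comp_functor C P1 ?EP) P1" "iso (LQ ?Y M1) ?f"
      and g: "?g \<in> hom (LQ ?Y M2) (comp_functor C P2 ?EP) P2" "iso (LQ ?Y M2) ?g"
      using lqP isoA isoB by (simp_all add: LQ_hom LQ_iso_iff nat_iso_def)
    have id: "Far (LQ_postcomp ?Y M2 ?I) ?g = ?g" "Far (LQ_postcomp ?Y M1 ?I) ?f = ?f"
      using LQ_postcomp_id(2)[of ?g ?Y M2] LQ_postcomp_id(2)[of ?f ?Y M1]
        homD(1)[OF f(1)] homD(1)[OF g(1)] by simp_all
    \<comment> \<open>The compatibility square of \<open>(\<alpha>P1, \<phi> \<cdot> \<beta>P1)\<close>, reduced to \<open>\<beta> \<cdot> \<phi>E = \<alpha>\<close> at \<open>P1 x\<close>.\<close>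
    have "(\<phi> x \<cdot>\<^bsub>M\<^esub> \<beta> (Fob P1 x)) \<cdot>\<^bsub>M\<^esub> \<phi> (Fob E (Fob P1 x)) = \<phi> x \<cdot>\<^bsub>M\<^esub> \<alpha> (Fob P1 x)"
      if x: "x \<in> Obj C" for x
    proof -
      have Px: "Fob P1 x \<in> Obj M" and EPx: "Fob E (Fob P1 x) \<in> Obj C"
        using functor_Obj[OF FP(1) x] functor_Obj[OF FE] by auto
      show ?thesis
        using M.Comp_assoc[OF nat_trans_hom[OF nt_\<phi> EPx] \<beta>_hom[OF Px] nat_trans_hom[OF nt_\<phi> x]]
          compatible[OF Px] by simp
    qed
    then have "?g \<cdot>\<^bsub>LQ ?Y M3\<^esub> (comp_functor C P1 ?EP, comp_functor C P2 ?EP, whisker_right C \<phi> ?EP) =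
        (P1, P2, \<phi>) \<cdot>\<^bsub>LQ ?Y M3\<^esub> ?f"
      by (simp add: whisker_right_def cong: restrict_cong)
    then have square: "Far (LQ_postcomp ?Y M2 ?I) ?g \<cdot>\<^bsub>LQ ?Y M3\<^esub>
          (comp_functor C P1 ?EP, comp_functor C P2 ?EP, whisker_right C \<phi> ?EP) =
        (P1, P2, \<phi>) \<cdot>\<^bsub>LQ ?Y M3\<^esub> Far (LQ_postcomp ?Y M1 ?I) ?f"
      unfolding id .
    have "Cof ?Y \<subseteq> Arr (Und ?Y)"
      by (auto simp: minimal_model_def)
    note postcomp = Quillen[THEN is_functor_LQ_postcomp, OF this]
    show ?thesis
      unfolding ob ob' LQ_pseudopullback_def
      by (rule pseudopullback_isomorphicI[OF postcomp obj[unfolded LQ_pseudopullback_def ob ob']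
            f g square])
  qed
  then have "isomorphic_objects (LQ ?Y M0) ?EP ?J"
    using equivalence_reflects_isomorphic[OF equivY] lqY by simp
  then obtain h where "h \<in> hom (LQ ?Y M0) ?EP ?J" "iso (LQ ?Y M0) h"
    by (auto simp: isomorphic_objects_def)
  then have EP: "isomorphic_functors C C ?EP ?J"
    using isomorphic_functorsI by (elim LQ_isoE) (auto simp: C_def)
  have "is_equivalence M C E"
    unfolding is_equivalence_def using FE FP(1) EP isomorphic_functorsI[OF \<alpha>] by blast
  then show ?thesis
    using isomorphic_functorsI[OF \<alpha>] isomorphic_functorsI[OF \<beta>] by (auto simp: C_def)
qed

end
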